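(* Let $F(z)=\sum_{k=0}^{n}A_kz^{n-k}\in\mathbb C[z]^{p\times p}$ be monic ($A_0=I_p$) of degree $n=2m$ or $n=2m+1$, and if $n=2m+1$ assume that the even part $F_e$ is regular. Let $\mathscr S$ be the sequence of right Markov parameters of $F$ when $n=2m$ (namely $(\mathbf s_k)_{k\ge0}$), resp. of right Markov parameters of first type when $n=2m+1$ (namely $(\mathbf s_k)_{k\ge-1}$), and assume that the truncated sequence $(\mathbf s_k)_{k=0}^{2m-1}$ (when $n=2m$), resp. $(\mathbf s_k)_{k=-1}^{2m-1}$ (when $n=2m+1$), consists of Hermitian matrices. Then $F$ is Hurwitz stable if and only if $H_{m-1}^{\langle\mathscr S\rangle}\succ0$ and $H_{1,m-1}^{\langle\mathscr S\rangle}\succ0$ and, in the case $n=2m+1$, additionally $\mathbf s_{-1}\succ0$.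
   Context: Even/odd parts: if $n=2m$, $F_e(z)=\sum_{k=0}^mA_{2k}z^{m-k}$, $F_o(z)=\sum_{k=1}^mA_{2k-1}z^{m-k}$; if $n=2m+1$, $F_e(z)=\sum_{k=0}^mA_{2k+1}z^{m-k}$, $F_o(z)=\sum_{k=0}^mA_{2k}z^{m-k}$. Right Markov parameters ($n=2m$): $F_o(z)F_e(z)^{-1}=\sum_{k\ge0}(-1)^kz^{-(k+1)}\mathbf s_k$ for large $|z|$. Right Markov parameters of first type ($n=2m+1$, $F_e$ regular, i.e. $\det F_e\not\equiv 0$): $F_o(z)F_e(z)^{-1}=\mathbf s_{-1}+\sum_{k\ge0}(-1)^kz^{-(k+1)}\mathbf s_k$ for large $|z|$. Block Hankel matrices: $H_{j,k}^{\langle\mathscr S\rangle}=[\mathbf s_{j+a+b}]_{a,b=0}^{k}$ and $H_k^{\langle\mathscr S\rangle}=H_{0,k}^{\langle\mathscr S\rangle}$ (built from $\mathbf s_0,\mathbf s_1,\dots$). $A\succ0$ means $A$ is positive definite. Hurwitz stable: all roots of $\det F(z)$ lie in $\operatorname{Re}z<0$. *)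

theory Defs
  imports Complex_Main "Jordan_Normal_Form.Determinant"
begin

definition mpoly_eval :: "nat \<Rightarrow> (nat \<Rightarrow> complex mat) \<Rightarrow> nat \<Rightarrow> complex \<Rightarrow> complex mat" where
  "mpoly_eval p C d z = mat p p (\<lambda>(i,j). \<Sum>k\<le>d. C k $$ (i,j) * z ^ (d - k))"

definition Fpoly :: "nat \<Rightarrow> nat \<Rightarrow> (nat \<Rightarrow> complex mat) \<Rightarrow> complex \<Rightarrow> complex mat" where
  "Fpoly p n A z = mpoly_eval p A n z"

definition Feven :: "nat \<Rightarrow> nat \<Rightarrow> (nat \<Rightarrow> complex mat) \<Rightarrow> complex \<Rightarrow> complex mat" where
  "Feven p n A z = (if even n then mpoly_eval p (\<lambda>k. A (2*k)) (n div 2) z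
                    else mpoly_eval p (\<lambda>k. A (2*k+1)) (n div 2) z)"

definition Fodd :: "nat \<Rightarrow> nat \<Rightarrow> (nat \<Rightarrow> complex mat) \<Rightarrow> complex \<Rightarrow> complex mat" where
  "Fodd p n A z = (if even n then
                     mat p p (\<lambda>(i,j). \<Sum>k\<in>{1..n div 2}. A (2*k-1) $$ (i,j) * z ^ (n div 2 - k))
                   else mpoly_eval p (\<lambda>k. A (2*k)) (n div 2) z)"

text \<open>Matrix inverse (meaningful for invertible square matrices).\<close>
definition mat_inv :: "complex mat \<Rightarrow> complex mat" where
  "mat_inv M = (SOME B. B \<in> carrier_mat (dim_row M) (dim_row M) \<and> M * B = 1\<^sub>m (dim_row M)
                        \<and> B * M = 1\<^sub>m (dim_row M))"

definition right_markov :: "nat \<Rightarrow> nat \<Rightarrow> (nat \<Rightarrow> complex mat) \<Rightarrow> (nat \<Rightarrow> complex mat) \<Rightarrow> bool" where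
  "right_markov p n A s \<longleftrightarrow> (\<forall>k. s k \<in> carrier_mat p p) \<and>
     (\<exists>R. \<forall>z. R < norm z \<longrightarrow> invertible_mat (Feven p n A z) \<and>
        (\<forall>i<p. \<forall>j<p. (\<lambda>k. (-1)^k / z^(k+1) * s k $$ (i,j)) sums
             ((Fodd p n A z * mat_inv (Feven p n A z)) $$ (i,j))))"

definition right_markov_first :: "nat \<Rightarrow> nat \<Rightarrow> (nat \<Rightarrow> complex mat) \<Rightarrow> complex mat \<Rightarrow> (nat \<Rightarrow> complex mat) \<Rightarrow> bool" where
  "right_markov_first p n A sm1 s \<longleftrightarrow> sm1 \<in> carrier_mat p p \<and> (\<forall>k. s k \<in> carrier_mat p p) \<and>
     (\<exists>R. \<forall>z. R < norm z \<longrightarrow> invertible_mat (Feven p n A z) \<and>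
        (\<forall>i<p. \<forall>j<p. (\<lambda>k. (-1)^k / z^(k+1) * s k $$ (i,j)) sums
             ((Fodd p n A z * mat_inv (Feven p n A z)) $$ (i,j) - sm1 $$ (i,j))))"

definition hermitian_mat :: "complex mat \<Rightarrow> bool" where
  "hermitian_mat M \<longleftrightarrow> dim_col M = dim_row M \<and>
     (\<forall>i<dim_row M. \<forall>j<dim_row M. M $$ (i,j) = cnj (M $$ (j,i)))"

definition pos_def_mat :: "complex mat \<Rightarrow> bool" where
  "pos_def_mat M \<longleftrightarrow> hermitian_mat M \<and>
     (\<forall>x::nat \<Rightarrow> complex. (\<exists>i<dim_row M. x i \<noteq> 0) \<longrightarrow>
        0 < Re (\<Sum>i<dim_row M. \<Sum>j<dim_row M. cnj (x i) * M $$ (i,j) * x j))"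

text \<open>Block Hankel matrix [s_{j+a+b}]_{a,b=0}^{N-1} with p x p blocks; H_{j,k} = block_hankel p s j (k+1).\<close>
definition block_hankel :: "nat \<Rightarrow> (nat \<Rightarrow> complex mat) \<Rightarrow> nat \<Rightarrow> nat \<Rightarrow> complex mat" where
  "block_hankel p s j N = mat (N*p) (N*p) (\<lambda>(a,b). s (j + a div p + b div p) $$ (a mod p, b mod p))"

definition hurwitz_stable :: "(complex \<Rightarrow> complex mat) \<Rightarrow> bool" where
  "hurwitz_stable F \<longleftrightarrow> (\<forall>z. det (F z) = 0 \<longrightarrow> Re z < 0)"

end

theory Submission
  imports Defs "Jordan_Normal_Form.Spectral_Radius"
begin

text \<open>
  Write \<open>F(z) = E(z\<^sup>2) + z O(z\<^sup>2)\<close> with \<open>E = F\<^sub>e\<close>, \<open>O = F\<^sub>o\<close>, and let \<open>z\<close> act as a shift on sequences \<open>f\<close>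
  of vectors. Let \<open>u\<^sub>x f\<close> (\<open>x < m\<close>) be \<open>f\<close> with the tail \<open>\<Sum>k>x. E\<^sub>k z\<^bsup>2(k-x-1)\<^esup>\<close> of \<open>E\<close> applied to it, and
  \<open>t\<^sub>k = (-1)\<^sup>k s\<^sub>k\<close>. The Markov expansion says that \<open>O f = s\<^sub>-\<^sub>1 E f + \<Sum>x. t\<^sub>x u\<^sub>x f\<close> and that
  \<open>h\<^sub>j = \<Sum>x. t\<^sub>j\<^sub>+\<^sub>x u\<^sub>x\<close> obeys \<open>h\<^sub>j z\<^sup>2 = h\<^sub>j\<^sub>+\<^sub>1 + t\<^sub>j E\<close>. Hence the Hermitian form
  \<open>V(f) = H\<^sub>1(u f) + H\<^sub>0(u (z f)) + \<langle>E f, s\<^sub>-\<^sub>1 E f\<rangle>\<close>, where \<open>H\<^sub>0, H\<^sub>1\<close> are the block Hankel forms applied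
  to the vectors \<open>(-1)\<^sup>x u\<^sub>x\<close> and \<open>s\<^sub>-\<^sub>1 = 0\<close> for even \<open>n\<close>, is a Lyapunov function: if \<open>F f = 0\<close>, its derivative
  along the flow \<open>f' = z f\<close> is \<open>-2 \<bar>E f\<bar>\<^sup>2\<close>. Moreover \<open>f \<mapsto> (u f, u (z f), E f)\<close> is onto, because the leading
  coefficient of \<open>E\<close> is invertible. So the right-hand side of the theorem says that \<open>V\<close> is positive.
  If it is, evaluate the identity on \<open>f\<^sub>i = \<nu>\<^sup>i v\<close> with \<open>F(\<nu>) v = 0\<close> to get \<open>Re \<nu> < 0\<close>. Conversely, if \<open>F\<close> is
  stable, \<open>V\<close> decreases to \<open>0\<close> along the Cayley transform of the companion matrix, so \<open>V \<ge> 0\<close>; a null vector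
  of \<open>V\<close> has \<open>E f = 0 = O f\<close> along its orbit, hence solves \<open>F(-z) f = 0\<close> as well and must vanish.
\<close>

subsection \<open>Lyapunov's theorem via the Cayley transform\<close>

text \<open>For \<open>r\<close> strictly between the spectral radius and 1, the matrix
  \<open>T / r\<close> still has spectral radius below 1, so its powers are bounded by the Jordan
  normal form; the factor \<open>r ^ k\<close> then forces decay.\<close>

lemma pow_mat_tendsto_zero:
  fixes T :: "complex mat"
  assumes T: "T \<in> carrier_mat N N" and ev: "\<And>\<mu>. eigenvalue T \<mu> \<Longrightarrow> cmod \<mu> < 1"
    and i: "i < N" and j: "j < N"
  shows "(\<lambda>k. (T ^\<^sub>m k) $$ (i,j)) \<longlonglongrightarrow> 0"
proof -
  from i have N: "N > 0" by simp
  have "spectral_radius T < 1"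
    using spectral_radius_mem_max(1)[OF T N] ev by (auto simp: spectrum_def)
  then obtain r where r: "max 0 (spectral_radius T) < r" "r < 1"
    using dense[of "max 0 (spectral_radius T)" 1] by auto
  define T' where "T' = complex_of_real (1/r) \<cdot>\<^sub>m T"
  have T': "T' \<in> carrier_mat N N" using T by (simp add: T'_def)
  have TT': "T = complex_of_real r \<cdot>\<^sub>m T'" using r T by (auto simp: T'_def)
  have "cmod \<nu> < 1" if "eigenvalue T' \<nu>" for \<nu>
  proof -
    from that obtain v where v: "v \<in> carrier_vec N" "v \<noteq> 0\<^sub>v N" "T' *\<^sub>v v = \<nu> \<cdot>\<^sub>v v"
      using T' by (auto simp: eigenvalue_def eigenvector_def)
    have "T *\<^sub>v v = (r * \<nu>) \<cdot>\<^sub>v v"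
    proof -
      have "T *\<^sub>v v = complex_of_real r \<cdot>\<^sub>v (T' *\<^sub>v v)"
        using v(1) T' unfolding TT'
        by (intro eq_vecI) (auto simp: scalar_prod_def sum_distrib_left mult.assoc intro!: sum.cong)
      then show ?thesis using v by (simp add: smult_smult_assoc)
    qed
    then have "eigenvalue T (r * \<nu>)" using v T by (auto simp: eigenvalue_def eigenvector_def)
    then have "cmod (r * \<nu>) \<in> norm ` spectrum T" by (auto simp: spectrum_def)
    from spectral_radius_mem_max(2)[OF T N this]
    have "r * cmod \<nu> \<le> spectral_radius T" using r by (simp add: norm_mult)
    also have "\<dots> < r * 1" using r by simp
    finally show ?thesis using r by (simp only: mult_less_cancel_left_pos)
  qed
  then have "spectral_radius T' < 1"
    using spectral_radius_mem_max(1)[OF T' N] by (auto simp: spectrum_def)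
  from spectral_radius_jnf_norm_bound_less_1[OF T' this jordan_nf_exists[OF T']]
  obtain c where c: "\<And>k. norm_bound (T' ^\<^sub>m k) c"
    using char_poly_factorized[OF T'] by blast
  have pw: "T ^\<^sub>m k = complex_of_real (r ^ k) \<cdot>\<^sub>m (T' ^\<^sub>m k)" for k
  proof (induction k)
    case (Suc k)
    have P: "T' ^\<^sub>m k \<in> carrier_mat N N" using T' by simp
    have "T ^\<^sub>m Suc k = (complex_of_real (r ^ k) \<cdot>\<^sub>m (T' ^\<^sub>m k)) * (complex_of_real r \<cdot>\<^sub>m T')"
      using Suc TT' by simp
    also have "\<dots> = complex_of_real (r ^ Suc k) \<cdot>\<^sub>m (T' ^\<^sub>m Suc k)"
      using P T' by (auto simp: mult_smult_distrib[of _ N N _ N] mult_smult_assoc_mat[of _ N N _ N])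
    finally show ?case .
  qed (use T T' in auto)
  have bound: "norm ((T ^\<^sub>m k) $$ (i,j)) \<le> r ^ k * c" for k
  proof -
    have "norm ((T' ^\<^sub>m k) $$ (i,j)) \<le> c" using c[of k] T' i j by (simp add: norm_bound_def)
    then show ?thesis using T' i j r by (simp add: pw norm_mult norm_power mult_left_mono)
  qed
  have lim: "(\<lambda>k. r ^ k * c) \<longlonglongrightarrow> 0"
    using r by (intro tendsto_mult_left_zero LIMSEQ_power_zero) auto
  have "(\<lambda>k. norm ((T ^\<^sub>m k) $$ (i,j))) \<longlonglongrightarrow> 0"
    by (rule tendsto_sandwich[OF eventuallyI eventuallyI tendsto_const lim]) (rule norm_ge_zero, rule bound)
  then show ?thesis by (rule tendsto_norm_zero_cancel)
qed

text \<open>The real part equals \<open>(|\<mu>|^2 - 1) / |\<mu> - 1|^2\<close>, so this Moebius map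
  matches the open unit disc with the open left half-plane.\<close>

lemma Re_moebius_neg_imp_norm_less_one:
  assumes "\<mu> \<noteq> 1" "Re ((\<mu> + 1) / (\<mu> - 1)) < 0"
  shows "cmod \<mu> < 1"
proof -
  have "(cmod (\<mu> - 1))\<^sup>2 > 0" using assms by simp
  moreover have "Re ((\<mu> + 1) / (\<mu> - 1)) = ((cmod \<mu>)\<^sup>2 - 1) / (cmod (\<mu> - 1))\<^sup>2"
    unfolding cmod_power2 by (simp add: Re_divide power2_eq_square algebra_simps)
  ultimately have "(cmod \<mu>)\<^sup>2 < 1" using assms by (simp add: divide_less_0_iff)
  then show ?thesis by (simp add: power2_less_1_iff)
qed

text \<open>\<open>R\<close> is the inverse of \<open>C - 1\<close>, which exists because the
  eigenvalue 1 is excluded, and \<open>T = (C + 1) R\<close>. Eigenvalues of \<open>T\<close> are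
  Moebius images of those of \<open>C\<close>, hence lie in the open unit disc.\<close>

lemma cayley_transform:
  fixes C :: "complex mat"
  assumes C: "C \<in> carrier_mat N N" and ev: "\<And>\<nu>. eigenvalue C \<nu> \<Longrightarrow> Re \<nu> < 0"
  obtains R T where "R \<in> carrier_mat N N" "T \<in> carrier_mat N N"
    "\<And>x. x \<in> carrier_vec N \<Longrightarrow> C *\<^sub>v (R *\<^sub>v x) - R *\<^sub>v x = x"
    "\<And>x. x \<in> carrier_vec N \<Longrightarrow> T *\<^sub>v (C *\<^sub>v x - x) = C *\<^sub>v x + x"
    "\<And>i j. i < N \<Longrightarrow> j < N \<Longrightarrow> (\<lambda>k. (T ^\<^sub>m k) $$ (i,j)) \<longlonglongrightarrow> 0"
proof -
  define D where "D = C - 1\<^sub>m N"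
  have D: "D \<in> carrier_mat N N" by (simp add: D_def minus_carrier_mat)
  have Dv: "D *\<^sub>v x = C *\<^sub>v x - x" if "x \<in> carrier_vec N" for x
    using that C by (simp add: D_def minus_mult_distrib_mat_vec)
  have "det D \<noteq> 0"
  proof
    assume "det D = 0"
    then obtain v where v: "v \<in> carrier_vec N" "v \<noteq> 0\<^sub>v N" "D *\<^sub>v v = 0\<^sub>v N"
      using det_0_iff_vec_prod_zero[OF D] by auto
    have "C *\<^sub>v v = 1 \<cdot>\<^sub>v v"
    proof (rule eq_vecI)
      fix i assume i: "i < dim_vec (1 \<cdot>\<^sub>v v)"
      have "(C *\<^sub>v v - v) $ i = 0" using v i Dv[OF v(1)] by auto
      then show "(C *\<^sub>v v) $ i = (1 \<cdot>\<^sub>v v) $ i" using i C v by simp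
    qed (use C v in auto)
    then have "eigenvalue C 1" using v C by (auto simp: eigenvalue_def eigenvector_def)
    from ev[OF this] show False by simp
  qed
  then obtain R where R: "R \<in> carrier_mat N N" "D * R = 1\<^sub>m N" "R * D = 1\<^sub>m N"
    using det_non_zero_imp_unit[OF D, where b = "()"] by (auto simp: Units_def ring_mat_def)
  define T where "T = (C + 1\<^sub>m N) * R"
  have T: "T \<in> carrier_mat N N" unfolding T_def by (rule mult_carrier_mat) (use C R in auto)
  have DR: "C *\<^sub>v (R *\<^sub>v x) - R *\<^sub>v x = x" if x: "x \<in> carrier_vec N" for x
  proof -
    have "D *\<^sub>v (R *\<^sub>v x) = x" using assoc_mult_mat_vec[OF D R(1) x] R x by simp
    then show ?thesis using Dv[of "R *\<^sub>v x"] R x by simp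
  qed
  have TD: "T *\<^sub>v (C *\<^sub>v x - x) = C *\<^sub>v x + x" if x: "x \<in> carrier_vec N" for x
  proof -
    have "R *\<^sub>v (D *\<^sub>v x) = x" using assoc_mult_mat_vec[OF R(1) D x] R x by simp
    moreover have "T *\<^sub>v (D *\<^sub>v x) = (C + 1\<^sub>m N) *\<^sub>v (R *\<^sub>v (D *\<^sub>v x))"
      unfolding T_def by (rule assoc_mult_mat_vec) (use C R D x in auto)
    moreover have "(C + 1\<^sub>m N) *\<^sub>v x = C *\<^sub>v x + x"
      using C x by (simp add: add_mult_distrib_mat_vec)
    ultimately show ?thesis using Dv[OF x] by simp
  qed
  have "cmod \<mu> < 1" if mu: "eigenvalue T \<mu>" for \<mu>
  proof -
    from mu obtain y where y: "y \<in> carrier_vec N" "y \<noteq> 0\<^sub>v N" "T *\<^sub>v y = \<mu> \<cdot>\<^sub>v y"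
      using T by (auto simp: eigenvalue_def eigenvector_def)
    \<comment> \<open>Pulling the eigenvector \<open>y\<close> of \<open>T\<close> back through
      \<open>C - 1\<close> gives an eigenvector of \<open>C\<close> for the eigenvalue
      \<open>(\<mu> + 1) / (\<mu> - 1)\<close>.\<close>
    define x where "x = R *\<^sub>v y"
    have x: "x \<in> carrier_vec N" using R y by (simp add: x_def)
    have yx: "y = C *\<^sub>v x - x" using DR[OF y(1)] by (simp add: x_def)
    have eq: "(C *\<^sub>v x + x) $ i = (\<mu> \<cdot>\<^sub>v (C *\<^sub>v x - x)) $ i" for i
      using TD[OF x] y(3) yx by simp
    have eq: "(C *\<^sub>v x) $ i + x $ i = \<mu> * ((C *\<^sub>v x) $ i - x $ i)" if "i < N" for i
      using eq[of i] that C x by simp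
    have x0: "x \<noteq> 0\<^sub>v N"
    proof
      assume "x = 0\<^sub>v N"
      then have "y = 0\<^sub>v N" using yx C by auto
      with y show False by simp
    qed
    have mu1: "\<mu> \<noteq> 1"
    proof
      assume "\<mu> = 1"
      then have "x $ i = 0" if "i < N" for i using eq[OF that] by simp
      then have "x = 0\<^sub>v N" using x by auto
      with x0 show False by simp
    qed
    have "C *\<^sub>v x = ((\<mu> + 1) / (\<mu> - 1)) \<cdot>\<^sub>v x"
    proof (rule eq_vecI)
      fix i assume "i < dim_vec (((\<mu> + 1) / (\<mu> - 1)) \<cdot>\<^sub>v x)"
      then have i: "i < N" using x by simp
      have "(\<mu> - 1) * (C *\<^sub>v x) $ i = (\<mu> + 1) * x $ i"
        using eq[OF i] by (simp add: algebra_simps)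
      then show "(C *\<^sub>v x) $ i = (((\<mu> + 1) / (\<mu> - 1)) \<cdot>\<^sub>v x) $ i"
        using mu1 i x C by (simp add: field_simps)
    qed (use C x in auto)
    then have "eigenvalue C ((\<mu> + 1) / (\<mu> - 1))"
      using x x0 C by (auto simp: eigenvalue_def eigenvector_def)
    from ev[OF this] show ?thesis by (rule Re_moebius_neg_imp_norm_less_one[OF mu1])
  qed
  from that[OF R(1) T DR TD pow_mat_tendsto_zero[OF T this]] show thesis by blast
qed

text \<open>The orbit \<open>y\<^sub>k = (C - 1) x\<^sub>k\<close> of the Cayley transform decreases \<open>q\<close> to \<open>0\<close>, so \<open>q y \<ge> 0\<close>. If \<open>q y = 0\<close>,
  then \<open>q\<close> is constant along the orbit; the symmetry \<open>J = diag \<sigma>\<close> then turns the orbit into one of the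
  inverse transform, which forces it to vanish.\<close>
lemma lyapunov_positive:
  fixes C :: "complex mat" and q e :: "complex vec \<Rightarrow> real" and \<sigma> :: "nat \<Rightarrow> complex"
  defines "J \<equiv> \<lambda>x. vec (dim_vec x) (\<lambda>i. \<sigma> i * x $ i)"
  assumes C: "C \<in> carrier_mat N N" and ev: "\<And>\<nu>. eigenvalue C \<nu> \<Longrightarrow> Re \<nu> < 0"
    and q: "\<And>x. x \<in> carrier_vec N \<Longrightarrow> q (C *\<^sub>v x + x) = q (C *\<^sub>v x - x) - e x"
    and e: "\<And>x. e x \<ge> 0"
    and q0: "\<And>y. (\<And>k. y k \<in> carrier_vec N) \<Longrightarrow> (\<And>i. i < N \<Longrightarrow> (\<lambda>k. y k $ i) \<longlonglongrightarrow> 0) \<Longrightarrow>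
               (\<lambda>k. q (y k)) \<longlonglongrightarrow> 0"
    and J: "\<And>x. x \<in> carrier_vec N \<Longrightarrow> e x = 0 \<Longrightarrow> C *\<^sub>v J x = - J (C *\<^sub>v x)"
    and \<sigma>: "\<And>i. i < N \<Longrightarrow> \<sigma> i \<noteq> 0"
    and y: "y \<in> carrier_vec N" "y \<noteq> 0\<^sub>v N"
  shows "q y > 0"
proof -
  obtain R T where R: "R \<in> carrier_mat N N" and T: "T \<in> carrier_mat N N"
    and DR: "\<And>x. x \<in> carrier_vec N \<Longrightarrow> C *\<^sub>v (R *\<^sub>v x) - R *\<^sub>v x = x"
    and TD: "\<And>x. x \<in> carrier_vec N \<Longrightarrow> T *\<^sub>v (C *\<^sub>v x - x) = C *\<^sub>v x + x"
    and T0: "\<And>i j. i < N \<Longrightarrow> j < N \<Longrightarrow> (\<lambda>k. (T ^\<^sub>m k) $$ (i,j)) \<longlonglongrightarrow> 0"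
    using cayley_transform[OF C ev] by metis
  define Y where "Y = (\<lambda>k. T ^\<^sub>m k *\<^sub>v y)"
  define X where "X = (\<lambda>k. R *\<^sub>v Y k)"
  have Y: "Y k \<in> carrier_vec N" for k
    using T y by (auto simp: Y_def intro!: mult_mat_vec_carrier)
  have X: "X k \<in> carrier_vec N" for k using R Y by (auto simp: X_def)
  have YX: "Y k = C *\<^sub>v X k - X k" for k using DR[OF Y] by (simp add: X_def)
  \<comment> \<open>The vector may vary with \<open>k\<close>: this serves the constant
    \<open>y\<close> now and the sequence \<open>Z\<close> later.\<close>
  have pow_lim: "(\<lambda>k. (T ^\<^sub>m k *\<^sub>v z k) $ i) \<longlonglongrightarrow> 0"
    if z: "\<And>k. z k \<in> carrier_vec N" "\<And>j. j < N \<Longrightarrow> (\<lambda>k. z k $ j) \<longlonglongrightarrow> L j" and i: "i < N" for z L i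
  proof -
    have "(T ^\<^sub>m k *\<^sub>v z k) $ i = (\<Sum>j<N. (T ^\<^sub>m k) $$ (i,j) * z k $ j)" for k
      using z(1)[of k] T i by (auto simp: scalar_prod_def lessThan_atLeast0 intro!: sum.cong)
    moreover have "(\<lambda>k. \<Sum>j<N. (T ^\<^sub>m k) $$ (i,j) * z k $ j) \<longlonglongrightarrow> (\<Sum>j<N. 0 * L j)"
      by (intro tendsto_sum tendsto_mult T0 z(2) i) auto
    ultimately show ?thesis by simp
  qed
  have Y0: "(\<lambda>k. Y k $ i) \<longlonglongrightarrow> 0" if "i < N" for i
    unfolding Y_def using pow_lim[of "\<lambda>_. y" "\<lambda>j. y $ j" i] y that by simp
  have YS: "Y (Suc k) = C *\<^sub>v X k + X k" for k
  proof -
    have "T ^\<^sub>m Suc k = T * T ^\<^sub>m k"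
      using T by (induction k) (auto simp: assoc_mult_mat[of _ N N _ N _ N])
    then have "Y (Suc k) = T *\<^sub>v Y k"
      unfolding Y_def using assoc_mult_mat_vec[OF T, of "T ^\<^sub>m k" N y] T y by simp
    then show ?thesis using TD[OF X] YX by simp
  qed
  have qstep: "q (Y (Suc k)) = q (Y k) - e (X k)" for k using q[OF X] YS YX by simp
  have "decseq (\<lambda>k. q (Y k))" unfolding decseq_Suc_iff using qstep e by simp
  have qlim: "(\<lambda>k. q (Y k)) \<longlonglongrightarrow> 0" by (rule q0[OF Y Y0])
  have nonneg: "q (Y k) \<ge> 0" for k using decseq_ge[OF \<open>decseq _\<close> qlim] .
  have Yy: "Y 0 = y" using T y by (simp add: Y_def)
  have "q y \<noteq> 0"
  proof
    assume qy: "q y = 0"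
    have "q (Y k) = 0" for k
      using decseqD[OF \<open>decseq _\<close>, of 0 k] nonneg[of k] qy Yy by simp
    then have e0: "e (X k) = 0" for k using qstep[of k] by simp
    \<comment> \<open>As \<open>C\<close> anticommutes with \<open>J\<close> on \<open>X k\<close>,
      this is \<open>- J (Y (Suc k))\<close>. Sign reversal swaps \<open>C - 1\<close> and
      \<open>C + 1\<close>, so \<open>T\<close> carries \<open>Z (Suc k)\<close> back to
      \<open>Z k\<close>. Then \<open>Z 0 = T ^ k Z k\<close> for all \<open>k\<close>, and both
      factors tend to 0.\<close>
    define Z where "Z = (\<lambda>k. C *\<^sub>v J (X k) - J (X k))"
    have JX: "J (X k) \<in> carrier_vec N" for k using X[of k] by (simp add: J_def)
    have Z: "Z k \<in> carrier_vec N" for k using C JX by (auto simp: Z_def)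
    have CJ: "(C *\<^sub>v J (X k)) $ i = - (\<sigma> i * (C *\<^sub>v X k) $ i)" if "i < N" for i k
      using J[OF X e0, of k] that C X[of k] by (simp add: J_def)
    have TZ: "T *\<^sub>v Z (Suc k) = Z k" for k
    proof -
      have "T *\<^sub>v Z (Suc k) = C *\<^sub>v J (X (Suc k)) + J (X (Suc k))"
        unfolding Z_def by (rule TD[OF JX])
      also have "\<dots> = Z k"
      proof (rule eq_vecI)
        fix i assume "i < dim_vec (Z k)"
        then have i: "i < N" using Z[of k] by simp
        have "Y (Suc k) $ i = (C *\<^sub>v X (Suc k)) $ i - X (Suc k) $ i"
          by (subst YX) (use C X[of "Suc k"] i in simp)
        moreover have "Y (Suc k) $ i = (C *\<^sub>v X k) $ i + X k $ i"
          by (subst YS) (use C X[of k] i in simp)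
        ultimately have "(C *\<^sub>v X (Suc k)) $ i = (C *\<^sub>v X k) $ i + X k $ i + X (Suc k) $ i" by simp
        then show "(C *\<^sub>v J (X (Suc k)) + J (X (Suc k))) $ i = Z k $ i"
          using C X[of k] X[of "Suc k"] i JX[of k] JX[of "Suc k"]
          by (simp add: Z_def CJ del: index_mult_mat_vec) (simp add: J_def algebra_simps del: index_mult_mat_vec)
      qed (use C JX Z in \<open>auto simp: Z_def J_def\<close>)
      finally show ?thesis .
    qed
    have Z0: "Z 0 = T ^\<^sub>m k *\<^sub>v Z k" for k
    proof (induction k)
      case (Suc k)
      then show ?case
        using TZ[of k] assoc_mult_mat_vec[of "T ^\<^sub>m k" N N T N "Z (Suc k)"] T Z by simp
    qed (use T Z in auto)
    have "(\<lambda>k. Z k $ i) \<longlonglongrightarrow> 0" if i: "i < N" for i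
    proof -
      have R_lim: "(\<lambda>k. X k $ j) \<longlonglongrightarrow> 0" if j: "j < N" for j
      proof -
        have "X k $ j = (\<Sum>l<N. R $$ (j,l) * Y k $ l)" for k
          using Y[of k] R j by (auto simp: X_def scalar_prod_def lessThan_atLeast0 intro!: sum.cong)
        moreover have "(\<lambda>k. \<Sum>l<N. R $$ (j,l) * Y k $ l) \<longlonglongrightarrow> (\<Sum>l<N. R $$ (j,l) * 0)"
          by (intro tendsto_intros Y0) auto
        ultimately show ?thesis by simp
      qed
      have "Z k $ i = (\<Sum>l<N. C $$ (i,l) * (\<sigma> l * X k $ l)) - \<sigma> i * X k $ i" for k
        using X[of k] C i
        by (auto simp: Z_def J_def scalar_prod_def lessThan_atLeast0 intro!: sum.cong)
      moreover have "(\<lambda>k. (\<Sum>l<N. C $$ (i,l) * (\<sigma> l * X k $ l)) - \<sigma> i * X k $ i)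
          \<longlonglongrightarrow> (\<Sum>l<N. C $$ (i,l) * (\<sigma> l * 0)) - \<sigma> i * 0"
        by (intro tendsto_intros R_lim i) auto
      ultimately show ?thesis by simp
    qed
    then have "(\<lambda>k. Z 0 $ i) \<longlonglongrightarrow> 0" if "i < N" for i
      using pow_lim[of Z "\<lambda>_. 0" i] Z Z0 that by simp
    then have Zi: "Z 0 $ i = 0" if "i < N" for i using that LIMSEQ_const_iff by blast
    \<comment> \<open>\<open>Z 0 = 0\<close> makes \<open>J (X 0)\<close> a fixed vector of
      \<open>C\<close>; since 1 is not an eigenvalue, it vanishes, and so do \<open>X 0\<close> and
      \<open>y\<close>.\<close>
    have CX1: "C *\<^sub>v J (X 0) = 1 \<cdot>\<^sub>v J (X 0)"
    proof (rule eq_vecI)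
      fix i assume "i < dim_vec (1 \<cdot>\<^sub>v J (X 0))"
      then have i: "i < N" using JX[of 0] by simp
      then show "(C *\<^sub>v J (X 0)) $ i = (1 \<cdot>\<^sub>v J (X 0)) $ i"
        using Zi[OF i] C JX[of 0] by (simp add: Z_def)
    qed (use C JX[of 0] in auto)
    have "J (X 0) = 0\<^sub>v N"
    proof (rule ccontr)
      assume "J (X 0) \<noteq> 0\<^sub>v N"
      then have "eigenvalue C 1" using CX1 JX C by (auto simp: eigenvalue_def eigenvector_def)
      from ev[OF this] show False by simp
    qed
    then have "X 0 $ i = 0" if "i < N" for i
      using that \<sigma>[OF that] X[of 0] by (auto simp: J_def dest!: arg_cong[where f = "\<lambda>v. v $ i"])
    then have "X 0 = 0\<^sub>v N" using X[of 0] by (intro eq_vecI) auto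
    then have "y = 0\<^sub>v N" using YX[of 0] Yy C by auto
    with y show False by simp
  qed
  with nonneg[of 0] Yy show ?thesis by simp
qed

section \<open>Comparing Laurent coefficients at infinity\<close>

text \<open>The point 0 is left out because \<open>x\<close> will be \<open>1 / z\<close>. The limit
  at 0 gives the constant term; dividing by \<open>x\<close> shifts the coefficients for the
  induction.\<close>

lemma powser_coeffs_zero:
  fixes d :: "nat \<Rightarrow> complex"
  assumes "r > 0" and "\<And>x. x \<noteq> 0 \<Longrightarrow> norm x < r \<Longrightarrow> (\<lambda>k. d k * x ^ k) sums 0"
  shows "d N = 0"
  using assms(2)
proof (induction N arbitrary: d)
  case 0
  have "((\<lambda>_. 0) \<longlongrightarrow> d 0) (at (0 :: complex))"
    using powser_limit_0_strong[OF \<open>r > 0\<close>, of d "\<lambda>_. 0"] 0 by blast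
  then show ?case by (simp add: tendsto_const_iff)
next
  case (Suc N)
  have "((\<lambda>_. 0) \<longlongrightarrow> d 0) (at (0 :: complex))"
    using powser_limit_0_strong[OF \<open>r > 0\<close>, of d "\<lambda>_. 0"] Suc.prems by blast
  then have d0: "d 0 = 0" by (simp add: tendsto_const_iff)
  have "(\<lambda>k. d (Suc k) * x ^ k) sums 0" if "x \<noteq> 0" "norm x < r" for x
  proof -
    have "(\<lambda>k. d (Suc k) * x ^ Suc k) sums 0"
      using Suc.prems[OF that] d0 by (subst sums_Suc_iff) simp
    from sums_mult[OF this, of "inverse x"] show ?thesis
      using that by (simp add: field_simps)
  qed
  then show ?case by (rule Suc.IH)
qed

text \<open>Put \<open>x = 1 / z\<close> and multiply \<open>eq\<close> by \<open>x ^ m\<close>: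
  both sides become power series in \<open>x\<close> and can be compared termwise. The power
  \<open>x ^ (m - j)\<close> yields the first relation, the powers beyond \<open>x ^ m\<close>,
  where the left side has no terms, the second. \<open>c l\<close> joins the value
  \<open>w l\<close> at infinity and the \<open>t l\<close> into one sequence.\<close>

lemma laurent_coeffs:
  fixes t e :: "nat \<Rightarrow> nat \<Rightarrow> complex" and w od :: "nat \<Rightarrow> complex"
  defines "c \<equiv> \<lambda>l k. if k = 0 then w l else t l (k - 1)"
  assumes sums: "\<And>z l. R < norm z \<Longrightarrow> l < p \<Longrightarrow> (\<lambda>k. t l k / z ^ (k + 1)) sums (g l z - w l)"
    and eq: "\<And>z. R < norm z \<Longrightarrow> (\<Sum>k\<le>m. od k * z ^ k) = (\<Sum>l<p. g l z * (\<Sum>k\<le>m. e l k * z ^ k))"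
  shows "j \<le> m \<Longrightarrow> od j = (\<Sum>l<p. \<Sum>k\<in>{j..m}. c l (k - j) * e l k)"
    and "(\<Sum>l<p. \<Sum>k\<le>m. c l (j + k + 1) * e l k) = 0"
proof -
  \<comment> \<open>\<open>sh b k\<close> is the coefficient sequence of \<open>x ^ (m - k)\<close>
    times the series with coefficients \<open>b\<close>.\<close>
  define sh where "sh = (\<lambda>(b :: nat \<Rightarrow> complex) k N. if m - k \<le> N then b (N - (m - k)) else 0)"
  define d where "d = (\<lambda>N. (\<Sum>k\<le>m. if N = m - k then od k else 0) -
      (\<Sum>l<p. \<Sum>k\<le>m. sh (c l) k N * e l k))"
  \<comment> \<open>Chosen so that \<open>norm x < r\<close> gives \<open>norm (1 / x) > R\<close>,
    also for negative \<open>R\<close>.\<close>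
  define r where "r = 1 / (max R 0 + 1)"
  have r: "r > 0" by (simp add: r_def add_nonneg_pos)
  have inv: "R < norm (1 / x)" if "x \<noteq> 0" "norm x < r" for x :: complex
  proof -
    have "1 / r < norm (1 / x)" using that r by (simp add: norm_divide frac_less2)
    then show ?thesis by (simp add: r_def)
  qed
  have W_sums: "(\<lambda>k. c l k * x ^ k) sums g l (1 / x)"
    if x: "x \<noteq> 0" "norm x < r" and l: "l < p" for x l
  proof -
    have "(\<lambda>k. c l (Suc k) * x ^ Suc k) sums (g l (1 / x) - w l)"
      using sums[OF inv[OF x] l] by (simp add: c_def power_divide)
    then show ?thesis by (subst (asm) sums_Suc_iff) (simp add: c_def)
  qed
  have "(\<lambda>N. d N * x ^ N) sums 0" if x: "x \<noteq> 0" "norm x < r" for x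
  proof -
    have sh_sums: "(\<lambda>N. sh (c l) k N * e l k * x ^ N) sums (x ^ (m - k) * g l (1 / x) * e l k)"
      if l: "l < p" for l k
    proof -
      have "(\<lambda>N. sh (c l) k (N + (m - k)) * x ^ (N + (m - k))) sums (x ^ (m - k) * g l (1 / x))"
        using sums_mult[OF W_sums[OF x l], of "x ^ (m - k)"] by (simp add: sh_def power_add mult_ac)
      then have "(\<lambda>N. sh (c l) k N * x ^ N) sums (x ^ (m - k) * g l (1 / x))"
        by (subst (asm) sums_zero_iff_shift) (auto simp: sh_def)
      from sums_mult2[OF this, of "e l k"] show ?thesis by (simp add: mult_ac)
    qed
    have rev: "x ^ m * (\<Sum>k\<le>m. b k * (1 / x) ^ k) = (\<Sum>k\<le>m. b k * x ^ (m - k))" for b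
      unfolding sum_distrib_left using x by (intro sum.cong) (auto simp: power_diff power_divide)
    have "(\<lambda>N. (\<Sum>k\<le>m. if N = m - k then od k * x ^ N else 0) -
        (\<Sum>l<p. \<Sum>k\<le>m. sh (c l) k N * e l k * x ^ N))
      sums ((\<Sum>k\<le>m. od k * x ^ (m - k)) - (\<Sum>l<p. \<Sum>k\<le>m. x ^ (m - k) * g l (1 / x) * e l k))"
      by (intro sums_diff sums_sum sh_sums) (auto intro: sums_single)
    also have "(\<Sum>l<p. \<Sum>k\<le>m. x ^ (m - k) * g l (1 / x) * e l k) =
        (\<Sum>l<p. g l (1 / x) * (\<Sum>k\<le>m. e l k * x ^ (m - k)))"
      by (simp add: sum_distrib_left mult_ac)
    also have "(\<Sum>k\<le>m. od k * x ^ (m - k)) - \<dots> = 0"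
      unfolding rev[symmetric] eq[OF inv[OF x]] by (simp add: sum_distrib_left mult_ac)
    also have "(\<lambda>N. (\<Sum>k\<le>m. if N = m - k then od k * x ^ N else 0) -
        (\<Sum>l<p. \<Sum>k\<le>m. sh (c l) k N * e l k * x ^ N)) = (\<lambda>N. d N * x ^ N)"
      by (simp add: d_def left_diff_distrib sum_distrib_right if_distrib[of "\<lambda>u. u * x ^ _"] cong: if_cong)
    finally show ?thesis .
  qed
  from powser_coeffs_zero[OF r this] have coef: "d N = 0" for N .
  show "od j = (\<Sum>l<p. \<Sum>k\<in>{j..m}. c l (k - j) * e l k)" if j: "j \<le> m"
  proof -
    have "(\<Sum>k\<le>m. if m - j = m - k then od k else 0) = (\<Sum>k\<le>m. if k = j then od j else 0)"
      using j by (intro sum.cong) auto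
    also have "\<dots> = od j" using j by simp
    finally have "od j = (\<Sum>l<p. \<Sum>k\<le>m. sh (c l) k (m - j) * e l k)"
      using coef[of "m - j"] unfolding d_def by simp
    also have "\<dots> = (\<Sum>l<p. \<Sum>k\<in>{j..m}. c l (k - j) * e l k)"
      using j by (intro sum.cong refl sum.mono_neutral_cong_right) (auto simp: sh_def)
    finally show ?thesis .
  qed
  show "(\<Sum>l<p. \<Sum>k\<le>m. c l (j + k + 1) * e l k) = 0"
  proof -
    have "(\<Sum>k\<le>m. if m + j + 1 = m - k then od k else 0) = 0"
      by (intro sum.neutral) auto
    then have "(\<Sum>l<p. \<Sum>k\<le>m. sh (c l) k (m + j + 1) * e l k) = 0"
      using coef[of "m + j + 1"] unfolding d_def by simp
    also have "(\<Sum>l<p. \<Sum>k\<le>m. sh (c l) k (m + j + 1) * e l k) = (\<Sum>l<p. \<Sum>k\<le>m. c l (j + k + 1) * e l k)"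
    proof (intro sum.cong refl)
      fix l k assume "k \<in> {..m}"
      then have "m + j + 1 - (m - k) = j + k + 1" "m - k \<le> m + j + 1" by auto
      then show "sh (c l) k (m + j + 1) * e l k = c l (j + k + 1) * e l k" by (simp add: sh_def)
    qed
    finally show ?thesis .
  qed
qed

section \<open>Linear algebra on vectors and matrices given as functions of their indices\<close>

definition mv :: "nat \<Rightarrow> (nat \<Rightarrow> nat \<Rightarrow> complex) \<Rightarrow> (nat \<Rightarrow> complex) \<Rightarrow> nat \<Rightarrow> complex" where
  "mv p M v r = (\<Sum>c<p. M r c * v c)"

definition mm :: "nat \<Rightarrow> (nat \<Rightarrow> nat \<Rightarrow> complex) \<Rightarrow> (nat \<Rightarrow> nat \<Rightarrow> complex) \<Rightarrow> nat \<Rightarrow> nat \<Rightarrow> complex" where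
  "mm p M M' r c = (\<Sum>l<p. M r l * M' l c)"

definition ip :: "nat \<Rightarrow> (nat \<Rightarrow> complex) \<Rightarrow> (nat \<Rightarrow> complex) \<Rightarrow> complex" where
  "ip p v w = (\<Sum>r<p. cnj (v r) * w r)"

lemma mv_add: "mv p M (\<lambda>c. v c + w c) r = mv p M v r + mv p M w r"
  by (simp add: mv_def algebra_simps sum.distrib)

lemma mv_scale: "mv p M (\<lambda>c. s * v c) r = s * mv p M v r"
  by (simp add: mv_def algebra_simps sum_distrib_left)

lemma mv_minus: "mv p M (\<lambda>c. - v c) r = - mv p M v r"
  by (simp add: mv_def sum_negf)

lemma mv_sum: "mv p M (\<lambda>c. \<Sum>k\<in>K. v k c) r = (\<Sum>k\<in>K. mv p M (v k) r)"
  by (simp add: mv_def sum_distrib_left) (rule sum.swap)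

lemma mv_sum_mat: "mv p (\<lambda>r c. \<Sum>k\<in>K. M k r c) v r = (\<Sum>k\<in>K. mv p (M k) v r)"
  by (simp add: mv_def sum_distrib_right) (rule sum.swap)

lemma mv_mm: "mv p (mm p M M') v r = mv p M (mv p M' v) r"
  by (simp add: mv_def mm_def sum_distrib_left sum_distrib_right mult.assoc) (rule sum.swap)

lemma mv_cong: "(\<And>c. c < p \<Longrightarrow> v c = w c) \<Longrightarrow> mv p M v r = mv p M w r"
  by (simp add: mv_def)

lemma ip_add_right: "ip p v (\<lambda>r. w r + w' r) = ip p v w + ip p v w'"
  by (simp add: ip_def algebra_simps sum.distrib)

lemma ip_add_left: "ip p (\<lambda>r. v r + v' r) w = ip p v w + ip p v' w"
  by (simp add: ip_def algebra_simps sum.distrib)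

lemma ip_scale_right: "ip p v (\<lambda>r. s * w r) = s * ip p v w"
  by (simp add: ip_def algebra_simps sum_distrib_left)

lemma ip_scale_left: "ip p (\<lambda>r. s * v r) w = cnj s * ip p v w"
  by (simp add: ip_def algebra_simps sum_distrib_left)

lemma ip_sum_right: "ip p v (\<lambda>r. \<Sum>k\<in>K. w k r) = (\<Sum>k\<in>K. ip p v (w k))"
  by (simp add: ip_def sum_distrib_left) (rule sum.swap)

lemma ip_cong: "(\<And>r. r < p \<Longrightarrow> v r = v' r) \<Longrightarrow> (\<And>r. r < p \<Longrightarrow> w r = w' r) \<Longrightarrow> ip p v w = ip p v' w'"
  by (simp add: ip_def)

lemma Re_ip_self: "Re (ip p v v) = (\<Sum>r<p. (cmod (v r))\<^sup>2)"
  by (simp add: ip_def cmod_power2) (simp add: power2_eq_square)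

lemma Re_ip_self_nonneg: "Re (ip p v v) \<ge> 0"
  by (simp add: Re_ip_self sum_nonneg)

lemma Re_ip_self_eq_0_iff: "Re (ip p v v) = 0 \<longleftrightarrow> (\<forall>r<p. v r = 0)"
  by (auto simp: Re_ip_self sum_nonneg_eq_0_iff)

lemma ip_mv_hermitian:
  assumes "\<And>r c. M c r = cnj (M r c)"
  shows "ip p v (mv p M w) = cnj (ip p w (mv p M v))"
proof -
  have "ip p v (mv p M w) = (\<Sum>r<p. \<Sum>c<p. cnj (v r) * M r c * w c)"
    by (simp add: ip_def mv_def sum_distrib_left mult.assoc)
  also have "\<dots> = (\<Sum>c<p. \<Sum>r<p. cnj (v r) * M r c * w c)" by (rule sum.swap)
  also have "\<dots> = cnj (ip p w (mv p M v))"
    unfolding ip_def mv_def sum_distrib_left cnj_sum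
  proof (intro sum.cong refl)
    fix r c
    show "cnj (v r) * M r c * w c = cnj (cnj (w c) * (M c r * v r))"
      by (simp add: assms[of c r])
  qed
  finally show ?thesis .
qed

section \<open>Block Hankel forms and block indices\<close>

definition hankel_form ::
  "nat \<Rightarrow> nat \<Rightarrow> (nat \<Rightarrow> nat \<Rightarrow> nat \<Rightarrow> complex) \<Rightarrow> nat \<Rightarrow> (nat \<Rightarrow> nat \<Rightarrow> complex) \<Rightarrow> (nat \<Rightarrow> nat \<Rightarrow> complex) \<Rightarrow> complex"
  where "hankel_form p m t d u w = (\<Sum>x<m. \<Sum>y<m. ip p (u x) (mv p (t (d + x + y)) (w y)))"

text \<open>For \<open>d \<le> 1\<close> the index \<open>d + x + y\<close> is at most
  \<open>2 * m - 1\<close>, so only coefficients known to be Hermitian occur.\<close>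

lemma hankel_form_hermitian:
  assumes "\<And>k r c. k < 2 * m \<Longrightarrow> t k c r = cnj (t k r c)" "d \<le> 1"
  shows "hankel_form p m t d u w = cnj (hankel_form p m t d w u)"
proof -
  have "hankel_form p m t d u w = (\<Sum>x<m. \<Sum>y<m. cnj (ip p (w y) (mv p (t (d + y + x)) (u x))))"
    unfolding hankel_form_def
  proof (intro sum.cong refl)
    fix x y assume "x \<in> {..<m}" "y \<in> {..<m}"
    then have "d + y + x < 2 * m" "d + x + y = d + y + x" using assms(2) by auto
    then show "ip p (u x) (mv p (t (d + x + y)) (w y)) = cnj (ip p (w y) (mv p (t (d + y + x)) (u x)))"
      by (simp only:) (rule ip_mv_hermitian, rule assms(1))
  qed
  also have "\<dots> = cnj (hankel_form p m t d w u)"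
    unfolding hankel_form_def by (subst sum.swap) simp
  finally show ?thesis .
qed

lemma hankel_form_add_left:
  "hankel_form p m t d (\<lambda>x r. u x r + u' x r) w = hankel_form p m t d u w + hankel_form p m t d u' w"
  by (simp add: hankel_form_def ip_add_left sum.distrib)

lemma hankel_form_scale_left:
  "hankel_form p m t d (\<lambda>x r. s * u x r) w = cnj s * hankel_form p m t d u w"
  by (simp add: hankel_form_def ip_scale_left sum_distrib_left)

lemma hankel_form_cong:
  assumes "\<And>x r. x < m \<Longrightarrow> r < p \<Longrightarrow> u x r = u' x r" "\<And>x r. x < m \<Longrightarrow> r < p \<Longrightarrow> w x r = w' x r"
  shows "hankel_form p m t d u w = hankel_form p m t d u' w'"
proof -
  have "mv p M (w y) r = mv p M (w' y) r" if "y < m" for M y r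
    using assms(2)[OF that] by (rule mv_cong)
  then show ?thesis
    unfolding hankel_form_def using assms(1) by (intro sum.cong refl ip_cong) auto
qed

lemma hankel_form_zero:
  assumes "\<And>x r. x < m \<Longrightarrow> r < p \<Longrightarrow> u x r = 0"
  shows "hankel_form p m t d u w = 0"
  using assms by (simp add: hankel_form_def ip_def)

lemma sum_lessThan_mult:
  fixes g :: "nat \<Rightarrow> 'a::comm_monoid_add"
  shows "(\<Sum>b<n * p. g b) = (\<Sum>i<n. \<Sum>r<p. g (i * p + r))"
proof -
  have "(\<Sum>b<n * p. g b) = (\<Sum>i<n. sum g {i * p..<i * p + p})"
    by (rule sum.nat_group[symmetric])
  also have "\<dots> = (\<Sum>i<n. \<Sum>r<p. g (i * p + r))"
  proof (rule sum.cong[OF refl])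
    fix i
    show "sum g {i * p..<i * p + p} = (\<Sum>r<p. g (i * p + r))"
      by (simp add: sum.atLeastLessThan_shift_0[of g "i * p"] atLeast0LessThan comp_def)
  qed
  finally show ?thesis .
qed

lemma block_index_less: "i * p + r < n * p" if "i < n" "r < p" for i n p r :: nat
proof -
  have "i * p + r < Suc i * p" using that by simp
  also have "\<dots> \<le> n * p" using that by (intro mult_right_mono) auto
  finally show ?thesis .
qed

lemma block_div_less: "b div p < n" "b mod p < p" if "b < n * p" for b n p :: nat
  using that by (auto simp: less_mult_imp_div_less intro!: mod_less_divisor gr0I)

subsection \<open>The Lyapunov function of a Markov sequence\<close>

text \<open>Here \<open>a i\<close> is the coefficient of \<open>z\<^sup>i\<close> in \<open>F\<close>, so \<open>E\<^sub>k = a (2k)\<close> and \<open>O\<^sub>k = a (2k+1)\<close>, and \<open>t k\<close> stands for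
  \<open>(-1)\<^sup>k s\<^sub>k\<close>; matrices and vectors are functions of which only the entries with indices below \<open>p\<close> matter.\<close>

locale markov_polynomial =
  fixes p m :: nat and a t :: "nat \<Rightarrow> nat \<Rightarrow> nat \<Rightarrow> complex" and S :: "nat \<Rightarrow> nat \<Rightarrow> complex"
  assumes odd_coeff: "j \<le> m \<Longrightarrow>
      a (2*j+1) r c = mm p S (a (2*j)) r c + (\<Sum>k\<in>{j<..m}. mm p (t (k-j-1)) (a (2*k)) r c)"
    and annihil: "(\<Sum>k\<le>m. mm p (t (j+k)) (a (2*k)) r c) = 0"
    and herm_t: "k < 2*m \<Longrightarrow> t k c r = cnj (t k r c)"
    and herm_S: "S c r = cnj (S r c)"
    and lead_surj: "\<exists>v. \<forall>r<p. mv p (a (2*m)) v r = w r"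
    and lead_inj: "(\<And>r. r < p \<Longrightarrow> mv p (a (2*m)) v r = 0) \<Longrightarrow> r < p \<Longrightarrow> v r = 0"
begin

text \<open>The operators of the overview, with \<open>i\<close> counting further shifts:
  \<open>tail_op 0\<close> is \<open>E\<close>, \<open>tail_op (x+1)\<close> is \<open>u_x\<close>,
  and below \<open>hankel_op j\<close> is \<open>h_j\<close> and \<open>odd_op\<close> is
  \<open>O\<close>. Position 1 thus belongs to \<open>z f\<close>.\<close>

definition tail_op :: "nat \<Rightarrow> (nat \<Rightarrow> nat \<Rightarrow> complex) \<Rightarrow> nat \<Rightarrow> nat \<Rightarrow> complex" where
  "tail_op b f i r = (\<Sum>k\<in>{b..m}. mv p (a (2*k)) (f (i + 2*(k-b))) r)"

definition hankel_op :: "nat \<Rightarrow> (nat \<Rightarrow> nat \<Rightarrow> complex) \<Rightarrow> nat \<Rightarrow> nat \<Rightarrow> complex" where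
  "hankel_op j f i r = (\<Sum>x<m. mv p (t (j+x)) (tail_op (x+1) f i) r)"

definition odd_op :: "(nat \<Rightarrow> nat \<Rightarrow> complex) \<Rightarrow> nat \<Rightarrow> nat \<Rightarrow> complex" where
  "odd_op f i r = (\<Sum>k\<le>m. mv p (a (2*k+1)) (f (i+2*k)) r)"

text \<open>A Horner step for \<open>E\<close> as a polynomial in \<open>z^2\<close>.\<close>

lemma tail_op_step: "b \<le> m \<Longrightarrow> tail_op b f i r = mv p (a (2*b)) (f i) r + tail_op (b+1) f (i+2) r"
proof -
  assume b: "b \<le> m"
  have "tail_op b f i r = mv p (a (2*b)) (f i) r + (\<Sum>k\<in>{b+1..m}. mv p (a (2*k)) (f (i + 2*(k-b))) r)"
    using b by (simp add: tail_op_def sum.atLeast_Suc_atMost)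
  also have "(\<Sum>k\<in>{b+1..m}. mv p (a (2*k)) (f (i + 2*(k-b))) r) = tail_op (b+1) f (i+2) r"
    unfolding tail_op_def
  proof (intro sum.cong refl)
    fix k assume "k \<in> {b+1..m}"
    then have "i + 2*(k-b) = i + 2 + 2*(k-(b+1))" unfolding atLeastAtMost_iff by arith
    then show "mv p (a (2*k)) (f (i + 2*(k-b))) r = mv p (a (2*k)) (f (i + 2 + 2*(k-(b+1)))) r"
      by (simp only:)
  qed
  finally show ?thesis .
qed

text \<open>The recurrence for \<open>h_j\<close>: a Horner step in each tail splits off the sum of
  all \<open>t (j+x) E_x\<close>, which is 0 by \<open>annihil\<close>.\<close>

lemma hankel_op_step: "hankel_op j f (i+2) r = hankel_op (j+1) f i r + mv p (t j) (tail_op 0 f i) r"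
proof -
  have "hankel_op (j+1) f i r + mv p (t j) (tail_op 0 f i) r = (\<Sum>x\<le>m. mv p (t (j+x)) (tail_op x f i) r)"
    by (simp add: hankel_op_def lessThan_Suc_atMost[symmetric] sum.lessThan_Suc_shift del: sum.lessThan_Suc)
  also have "\<dots> = (\<Sum>x\<le>m. mv p (mm p (t (j+x)) (a (2*x))) (f i) r + mv p (t (j+x)) (tail_op (x+1) f (i+2)) r)"
  proof (intro sum.cong refl)
    fix x assume "x \<in> {..m}"
    then have "tail_op x f i = (\<lambda>r. mv p (a (2*x)) (f i) r + tail_op (x+1) f (i+2) r)"
      by (intro ext tail_op_step) simp
    then show "mv p (t (j+x)) (tail_op x f i) r =
        mv p (mm p (t (j+x)) (a (2*x))) (f i) r + mv p (t (j+x)) (tail_op (x+1) f (i+2)) r"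
      by (simp only: mv_add mv_mm)
  qed
  also have "\<dots> = (\<Sum>x\<le>m. mv p (t (j+x)) (tail_op (x+1) f (i+2)) r)"
    by (simp add: sum.distrib mv_sum_mat[symmetric] annihil) (simp add: mv_def)
  \<comment> \<open>The extra term \<open>x = m\<close> contains the empty tail
    \<open>tail_op (m+1)\<close>.\<close>
  also have "\<dots> = hankel_op j f (i+2) r"
    by (simp add: hankel_op_def lessThan_Suc_atMost[symmetric]) (simp add: tail_op_def mv_def)
  finally show ?thesis by simp
qed

text \<open>Insert \<open>odd_coeff\<close> and collect the double sum by
  \<open>x = k - j - 1\<close>.\<close>

lemma odd_op_eq: "odd_op f i r = mv p S (tail_op 0 f i) r + hankel_op 0 f i r"
proof -
  have aj: "a (2*j+1) = (\<lambda>r c. mm p S (a (2*j)) r c + (\<Sum>k\<in>{j<..m}. mm p (t (k-j-1)) (a (2*k)) r c))"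
    if "j \<le> m" for j using odd_coeff[OF that] by (intro ext)
  have "odd_op f i r = (\<Sum>j\<le>m. mv p S (mv p (a (2*j)) (f (i+2*j))) r +
      (\<Sum>k\<in>{j<..m}. mv p (t (k-j-1)) (mv p (a (2*k)) (f (i+2*j))) r))"
    unfolding odd_op_def
  proof (intro sum.cong refl)
    fix j assume "j \<in> {..m}"
    then have "j \<le> m" by simp
    have "mv p (\<lambda>r c. M r c + M' r c) v r = mv p M v r + mv p M' v r" for M M' v
      by (simp add: mv_def algebra_simps sum.distrib)
    then show "mv p (a (2*j+1)) (f (i+2*j)) r = mv p S (mv p (a (2*j)) (f (i+2*j))) r +
      (\<Sum>k\<in>{j<..m}. mv p (t (k-j-1)) (mv p (a (2*k)) (f (i+2*j))) r)"
      unfolding aj[OF \<open>j \<le> m\<close>] by (simp add: mv_sum_mat mv_mm mv_mm[abs_def])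
  qed
  also have "\<dots> = mv p S (tail_op 0 f i) r + (\<Sum>j\<le>m. \<Sum>k\<in>{j<..m}. mv p (t (k-j-1)) (mv p (a (2*k)) (f (i+2*j))) r)"
    by (simp add: sum.distrib tail_op_def[abs_def] mv_sum atLeast0AtMost)
  also have "(\<Sum>j\<le>m. \<Sum>k\<in>{j<..m}. mv p (t (k-j-1)) (mv p (a (2*k)) (f (i+2*j))) r) =
      (\<Sum>x<m. \<Sum>k\<in>{x+1..m}. mv p (t x) (mv p (a (2*k)) (f (i+2*(k-(x+1))))) r)"
    unfolding sum.Sigma[OF finite_atMost ballI[OF finite_greaterThanAtMost]]
      sum.Sigma[OF finite_lessThan ballI[OF finite_atLeastAtMost]]
    by (rule sum.reindex_bij_witness[of _ "\<lambda>(x,k). (k-(x+1),k)" "\<lambda>(j,k). (k-j-1,k)"]) auto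
  also have "\<dots> = hankel_op 0 f i r" by (simp add: hankel_op_def tail_op_def[abs_def] mv_sum)
  finally show ?thesis .
qed

text \<open>The sesquilinear form belonging to \<open>V\<close>. The minus sign is due to the factor
  \<open>(-1)^k\<close> in \<open>t\<close>: with alternating signs on the block vectors,
  \<open>hankel_form p m t 1\<close> is minus the form of \<open>H_1\<close>.\<close>

definition energy :: "(nat \<Rightarrow> nat \<Rightarrow> complex) \<Rightarrow> (nat \<Rightarrow> nat \<Rightarrow> complex) \<Rightarrow> complex" where
  "energy f g = hankel_form p m t 0 (\<lambda>x. tail_op (x+1) f 1) (\<lambda>x. tail_op (x+1) g 1)
     - hankel_form p m t 1 (\<lambda>x. tail_op (x+1) f 0) (\<lambda>x. tail_op (x+1) g 0)
     + ip p (tail_op 0 f 0) (mv p S (tail_op 0 g 0))"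

lemma hankel_form_h: "hankel_form p m t d u (\<lambda>x. tail_op (x+1) f i) = (\<Sum>x<m. ip p (u x) (hankel_op (d+x) f i))"
  unfolding hankel_form_def hankel_op_def[abs_def] ip_sum_right ..

lemma tail_op_shift: "tail_op b (\<lambda>i. f (i+1)) i = tail_op b f (i+1)"
  by (intro ext) (simp add: tail_op_def)

text \<open>The left side is half the derivative of \<open>V\<close> along \<open>f' = z f\<close>.
  Rewriting \<open>h_x z^2\<close> by the recurrence produces the cross term of \<open>H_1\<close>
  once more, with its arguments swapped, so it cancels in the real part. What remains is the product
  of \<open>E f\<close> with \<open>O (z f)\<close>, which equals \<open>- E f\<close>.\<close>

lemma lyapunov_identity:
  assumes f: "\<And>r. r < p \<Longrightarrow> tail_op 0 f 0 r + odd_op f 1 r = 0"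
  shows "Re (energy f (\<lambda>i. f (i+1))) = - Re (ip p (tail_op 0 f 0) (tail_op 0 f 0))"
proof -
  let ?u = "\<lambda>i x. tail_op (x+1) f i" and ?E = "tail_op 0 f"
  have h2: "hankel_op j f 2 = (\<lambda>r. hankel_op (j+1) f 0 r + mv p (t j) (?E 0) r)" for j
    using hankel_op_step[of j f 0] by (intro ext) (simp add: numeral_2_eq_2)
  have "hankel_form p m t 0 (?u 1) (?u 2) = (\<Sum>x<m. ip p (?u 1 x) (hankel_op (x+1) f 0))
      + (\<Sum>x<m. ip p (?u 1 x) (mv p (t x) (?E 0)))"
    unfolding hankel_form_h by (simp add: h2 ip_add_right sum.distrib)
  also have "(\<Sum>x<m. ip p (?u 1 x) (hankel_op (x+1) f 0)) = hankel_form p m t 1 (?u 1) (?u 0)"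
    unfolding hankel_form_h by simp
  also have "(\<Sum>x<m. ip p (?u 1 x) (mv p (t x) (?E 0))) = (\<Sum>x<m. cnj (ip p (?E 0) (mv p (t x) (?u 1 x))))"
    by (intro sum.cong refl ip_mv_hermitian herm_t) auto
  also have "\<dots> = cnj (ip p (?E 0) (hankel_op 0 f 1))"
    by (simp add: hankel_op_def[abs_def] ip_sum_right)
  finally have 1: "hankel_form p m t 0 (?u 1) (?u 2) =
      hankel_form p m t 1 (?u 1) (?u 0) + cnj (ip p (?E 0) (hankel_op 0 f 1))" .
  have 2: "hankel_form p m t 1 (?u 1) (?u 0) = cnj (hankel_form p m t 1 (?u 0) (?u 1))"
    by (rule hankel_form_hermitian[OF herm_t]) auto
  have split: "energy f (\<lambda>i. f (i+1)) = hankel_form p m t 0 (?u 1) (?u 2) - hankel_form p m t 1 (?u 0) (?u 1)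
      + ip p (?E 0) (mv p S (?E 1))"
    unfolding energy_def tail_op_shift by (simp add: numeral_2_eq_2)
  \<comment> \<open>The two \<open>hankel_form p m t 1\<close> terms are conjugate to each other, so
    their difference is imaginary.\<close>
  have "Re (energy f (\<lambda>i. f (i+1))) = Re (ip p (?E 0) (hankel_op 0 f 1) + ip p (?E 0) (mv p S (?E 1)))"
    unfolding split 1 2 by simp
  also have "ip p (?E 0) (hankel_op 0 f 1) + ip p (?E 0) (mv p S (?E 1)) = ip p (?E 0) (odd_op f 1)"
    unfolding odd_op_eq[abs_def] by (simp add: ip_add_right)
  also have "\<dots> = ip p (?E 0) (\<lambda>r. -1 * ?E 0 r)"
    using f by (intro ip_cong) (auto simp: add_eq_0_iff2 minus_equation_iff)
  also have "\<dots> = - ip p (?E 0) (?E 0)" unfolding ip_scale_right by simp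
  finally show ?thesis by simp
qed

lemma energy_hermitian: "energy f g = cnj (energy g f)"
proof -
  have i: "ip p (tail_op 0 f 0) (mv p S (tail_op 0 g 0)) = cnj (ip p (tail_op 0 g 0) (mv p S (tail_op 0 f 0)))"
    by (rule ip_mv_hermitian[OF herm_S])
  have hf: "hankel_form p m t d u w = cnj (hankel_form p m t d w u)" if "d \<le> 1" for d u w
    by (rule hankel_form_hermitian[OF herm_t that])
  show ?thesis unfolding energy_def complex_cnj_add complex_cnj_diff
    by (intro arg_cong2[where f = "(+)"] arg_cong2[where f = "(-)"] i hf) auto
qed

lemma tail_op_add_scale: "tail_op b (\<lambda>i r. f i r + s * g i r) i = (\<lambda>r. tail_op b f i r + s * tail_op b g i r)"
  by (intro ext) (simp only: tail_op_def mv_add mv_scale sum.distrib sum_distrib_left)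

lemma energy_add_scale_left: "energy (\<lambda>i r. f i r + s * g i r) k = energy f k + cnj s * energy g k"
  unfolding energy_def tail_op_add_scale hankel_form_add_left hankel_form_scale_left ip_add_left ip_scale_left
  by (simp add: algebra_simps)

lemma energy_add_scale_right: "energy k (\<lambda>i r. f i r + s * g i r) = energy k f + s * energy k g"
proof -
  have "energy k (\<lambda>i r. f i r + s * g i r) = cnj (energy (\<lambda>i r. f i r + s * g i r) k)" by (rule energy_hermitian)
  also have "\<dots> = cnj (energy f k) + s * cnj (energy g k)" unfolding energy_add_scale_left by simp
  finally show ?thesis unfolding energy_hermitian[of k f] energy_hermitian[of k g] .
qed

text \<open>For \<open>g = z f\<close> the arguments are \<open>(z + 1) f\<close> and
  \<open>(z - 1) f\<close>, so one step of the Cayley transform changes the energy by four times the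
  quantity in \<open>lyapunov_identity\<close>.\<close>

lemma Re_energy_polarization:
  "Re (energy (\<lambda>i r. g i r + f i r) (\<lambda>i r. g i r + f i r)) =
   Re (energy (\<lambda>i r. g i r - f i r) (\<lambda>i r. g i r - f i r)) + 4 * Re (energy f g)"
proof -
  have "Re (energy g f) = Re (energy f g)" by (subst energy_hermitian) simp
  then show ?thesis
    using energy_add_scale_left[of g 1 f] energy_add_scale_left[of g "-1" f]
      energy_add_scale_right[of _ g 1 f] energy_add_scale_right[of _ g "-1" f] by simp
qed

text \<open>Tails at position 0 read only even entries of \<open>f\<close>, those at position 1 only
  odd ones, so the two families are independent. Each is a block triangular system with the
  surjective leading coefficient of \<open>E\<close> on the diagonal.\<close>

lemma tail_op_surj:
  "\<exists>f. (\<forall>b\<le>m. \<forall>r<p. tail_op b f 0 r = w b r) \<and> (\<forall>b\<le>m. \<forall>r<p. tail_op b f 1 r = w' b r)"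
proof -
  \<comment> \<open>Back substitution from \<open>b = m\<close> downwards: equation
    \<open>b = m - s\<close> involves \<open>g 0, ..., g s\<close>, and \<open>g s\<close> meets
    only \<open>a (2*m)\<close>.\<close>
  have rec: "\<exists>g. \<forall>s<n. \<forall>r<p. (\<Sum>k\<in>{m-s..m}. mv p (a (2*k)) (g (k - (m-s))) r) = w (m-s) r"
    if "n \<le> m + 1" for w :: "nat \<Rightarrow> nat \<Rightarrow> complex" and n
    using that
  proof (induction n)
    case (Suc n)
    have "n \<le> m + 1" using Suc.prems by simp
    from Suc.IH[OF this] obtain g where "\<forall>s<n. \<forall>r<p.
        (\<Sum>k\<in>{m-s..m}. mv p (a (2*k)) (g (k - (m-s))) r) = w (m-s) r" by blast
    then have g: "(\<Sum>k\<in>{m-s..m}. mv p (a (2*k)) (g (k - (m-s))) r) = w (m-s) r"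
      if "s < n" "r < p" for s r using that by blast
    from lead_surj[of "\<lambda>r. w (m-n) r - (\<Sum>k\<in>{m-n..<m}. mv p (a (2*k)) (g (k - (m-n))) r)"]
    obtain v where v: "\<And>r. r < p \<Longrightarrow> mv p (a (2*m)) v r =
        w (m-n) r - (\<Sum>k\<in>{m-n..<m}. mv p (a (2*k)) (g (k - (m-n))) r)"
      by blast
    have "(\<Sum>k\<in>{m-s..m}. mv p (a (2*k)) ((g(n := v)) (k - (m-s))) r) = w (m-s) r"
      if s: "s < Suc n" and r: "r < p" for s r
    proof (cases "s = n")
      case True
      have "(\<Sum>k\<in>{m-n..m}. mv p (a (2*k)) ((g(n := v)) (k - (m-n))) r) =
         (\<Sum>k\<in>{m-n..<m}. mv p (a (2*k)) ((g(n := v)) (k - (m-n))) r) + mv p (a (2*m)) v r"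
        using Suc.prems by (simp add: sum.last_plus)
      also have "(\<Sum>k\<in>{m-n..<m}. mv p (a (2*k)) ((g(n := v)) (k - (m-n))) r) =
          (\<Sum>k\<in>{m-n..<m}. mv p (a (2*k)) (g (k - (m-n))) r)"
        using Suc.prems by (intro sum.cong) auto
      finally show ?thesis using v[OF r] True by simp
    next
      case False
      then have "s < n" using s by simp
      then have "(\<Sum>k\<in>{m-s..m}. mv p (a (2*k)) ((g(n := v)) (k - (m-s))) r) =
          (\<Sum>k\<in>{m-s..m}. mv p (a (2*k)) (g (k - (m-s))) r)"
        using Suc.prems by (intro sum.cong) auto
      then show ?thesis using g[OF \<open>s < n\<close> r] by simp
    qed
    then show ?case by blast
  qed simp
  have rec': "\<exists>g. \<forall>s\<le>m. \<forall>r<p. (\<Sum>k\<in>{m-s..m}. mv p (a (2*k)) (g (k - (m-s))) r) = w (m-s) r" for w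
    using rec[of "m+1" w] unfolding Suc_eq_plus1[symmetric] less_Suc_eq_le by blast
  obtain g where g: "\<And>s r. s \<le> m \<Longrightarrow> r < p \<Longrightarrow>
      (\<Sum>k\<in>{m-s..m}. mv p (a (2*k)) (g (k - (m-s))) r) = w (m-s) r"
    using rec'[of w] by blast
  obtain g' where g': "\<And>s r. s \<le> m \<Longrightarrow> r < p \<Longrightarrow>
      (\<Sum>k\<in>{m-s..m}. mv p (a (2*k)) (g' (k - (m-s))) r) = w' (m-s) r"
    using rec'[of w'] by blast
  define f where "f = (\<lambda>i. if even i then g (i div 2) else g' (i div 2))"
  have "tail_op b f 0 r = w b r" "tail_op b f 1 r = w' b r" if "b \<le> m" "r < p" for b r
    using g[of "m-b" r] g'[of "m-b" r] that by (simp_all add: tail_op_def f_def)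
  then show ?thesis by blast
qed

text \<open>No term of \<open>energy\<close> is negative, and \<open>nz\<close> makes the last block
  \<open>u_(m-1)\<close> nonzero, so the \<open>t 1\<close> term is strict. For \<open>m = 0\<close>
  there are no Hankel blocks and strictness comes from \<open>S0\<close>.\<close>

lemma energy_pos:
  assumes pos0: "\<And>u. \<exists>x<m. \<exists>r<p. u x r \<noteq> 0 \<Longrightarrow> Re (hankel_form p m t 0 u u) > 0"
    and pos1: "\<And>u. \<exists>x<m. \<exists>r<p. u x r \<noteq> 0 \<Longrightarrow> Re (hankel_form p m t 1 u u) < 0"
    and S: "\<And>w. Re (ip p w (mv p S w)) \<ge> 0"
    and S0: "\<And>w. m = 0 \<Longrightarrow> \<exists>r<p. w r \<noteq> 0 \<Longrightarrow> Re (ip p w (mv p S w)) > 0"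
    and nz: "\<exists>r<p. tail_op m f 0 r \<noteq> 0"
  shows "Re (energy f f) > 0"
proof -
  have "Re (hankel_form p m t 0 u u) \<ge> 0" for u
    using pos0[of u] hankel_form_zero[of m p u t 0 u] by (cases "\<exists>x<m. \<exists>r<p. u x r \<noteq> 0") auto
  note n0 = this[of "\<lambda>x. tail_op (x+1) f 1"]
  show ?thesis
  proof (cases "m = 0")
    case True
    then have "Re (ip p (tail_op 0 f 0) (mv p S (tail_op 0 f 0))) > 0" using nz by (intro S0) auto
    moreover have "hankel_form p m t d u w = 0" for d u w using True by (simp add: hankel_form_def)
    ultimately show ?thesis unfolding energy_def by simp
  next
    case False
    then obtain m' where "m = m' + 1" by (metis Suc_eq_plus1 not0_implies_Suc)
    then have "\<exists>x<m. \<exists>r<p. tail_op (x+1) f 0 r \<noteq> 0" using nz by (intro exI[of _ m']) simp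
    from pos1[OF this] show ?thesis using n0 S[of "tail_op 0 f 0"] unfolding energy_def by simp
  qed
qed

text \<open>On the geometric sequence the shift is multiplication by \<open>\<nu>\<close>, so the
  Lyapunov identity reads \<open>Re \<nu> * V = - |E f|^2\<close>. With \<open>V > 0\<close> this
  leaves only the case \<open>E f = 0\<close>, which contradicts definiteness of the
  \<open>t 1\<close> form.\<close>

lemma eigenvalue_Re_neg:
  assumes pos0: "\<And>u. \<exists>x<m. \<exists>r<p. u x r \<noteq> 0 \<Longrightarrow> Re (hankel_form p m t 0 u u) > 0"
    and pos1: "\<And>u. \<exists>x<m. \<exists>r<p. u x r \<noteq> 0 \<Longrightarrow> Re (hankel_form p m t 1 u u) < 0"
    and S: "\<And>w. Re (ip p w (mv p S w)) \<ge> 0"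
    and S0: "\<And>w. m = 0 \<Longrightarrow> \<exists>r<p. w r \<noteq> 0 \<Longrightarrow> Re (ip p w (mv p S w)) > 0"
    and v: "\<exists>r<p. v r \<noteq> 0"
    and F: "\<And>r. r < p \<Longrightarrow> tail_op 0 (\<lambda>i r. \<nu> ^ i * v r) 0 r + odd_op (\<lambda>i r. \<nu> ^ i * v r) 1 r = 0"
  shows "Re \<nu> < 0"
proof -
  define f where "f = (\<lambda>i r. \<nu> ^ i * v r)"
  have Um: "tail_op m f i r = mv p (a (2*m)) (f i) r" for i r by (simp add: tail_op_def)
  have nz: "\<exists>r<p. tail_op m f 0 r \<noteq> 0"
  proof (rule ccontr)
    assume "\<not> ?thesis"
    then have "f 0 r = 0" if "r < p" for r using lead_inj[of "f 0" r] that by (auto simp: Um)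
    with v show False by (auto simp: f_def)
  qed
  have q: "Re (energy f f) > 0" by (rule energy_pos[OF pos0 pos1 S S0 nz])
  have sh: "(\<lambda>i. f (i+1)) = (\<lambda>i r. f i r + (\<nu> - 1) * f i r)"
    by (simp add: f_def algebra_simps)
  have Ush: "tail_op b f (i+1) = (\<lambda>r. \<nu> * tail_op b f i r)" for b i
    unfolding tail_op_shift[symmetric] sh tail_op_add_scale by (simp add: algebra_simps)
  have hsh: "hankel_op j f (i+1) r = \<nu> * hankel_op j f i r" for j i r
    unfolding hankel_op_def Ush mv_scale sum_distrib_left ..
  have "energy f (\<lambda>i. f (i+1)) = \<nu> * energy f f"
    unfolding sh energy_add_scale_right by (simp add: algebra_simps)
  moreover have "Im (energy f f) = 0" using energy_hermitian[of f f] by (metis Im_complex_of_real Reals_cases Reals_cnj_iff)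
  ultimately have main: "Re \<nu> * Re (energy f f) = - Re (ip p (tail_op 0 f 0) (tail_op 0 f 0))"
    using lyapunov_identity[of f] F by (simp add: f_def)
  show ?thesis
  proof (rule ccontr)
    assume "\<not> Re \<nu> < 0"
    then have "Re \<nu> * Re (energy f f) \<ge> 0" using q by simp
    then have "Re (ip p (tail_op 0 f 0) (tail_op 0 f 0)) = 0"
      using main Re_ip_self_nonneg[of p "tail_op 0 f 0"] by linarith
    then have E: "tail_op 0 f 0 r = 0" if "r < p" for r using that by (simp add: Re_ip_self_eq_0_iff)
    have E0: "mv p M (tail_op 0 f 0) r = 0" for M r using E by (simp add: mv_def)
    have m: "m > 0" using nz E by (cases m) auto
    \<comment> \<open>With \<open>E f = 0\<close>, the equation \<open>F f = 0\<close> becomes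
      \<open>h_0 (z f) = 0\<close>.\<close>
    have h0: "\<nu> * hankel_op 0 f 0 r = 0" if r: "r < p" for r
    proof -
      have "odd_op f 1 r = 0" using F[OF r] E[OF r] by (simp add: f_def)
      moreover have "tail_op 0 f 1 = (\<lambda>r. \<nu> * tail_op 0 f 0 r)" using Ush[of 0 0] by simp
      ultimately show ?thesis using hsh[of 0 0 r] by (simp add: odd_op_eq mv_scale E0)
    qed
    \<comment> \<open>The recurrence without its \<open>E\<close> term; it propagates
      \<open>\<nu> h_j f = 0\<close> to all \<open>j\<close> and yields
      \<open>h_(j+1) f = 0\<close>, even for \<open>\<nu> = 0\<close>.\<close>
    have hS: "hankel_op (j+1) f 0 r = \<nu> * (\<nu> * hankel_op j f 0 r)" for j r
      using hankel_op_step[of j f 0 r] hsh[of j 0 r] hsh[of j 1 r] by (simp add: E0 numeral_2_eq_2)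
    have hz: "\<nu> * hankel_op j f 0 r = 0" if "r < p" for j r
      using h0[OF that] by (induction j) (use hS in auto)
    have "hankel_form p m t 1 (\<lambda>x. tail_op (x+1) f 0) (\<lambda>x. tail_op (x+1) f 0) = 0"
      unfolding hankel_form_h using hS hz by (auto simp: ip_def intro!: sum.neutral)
    moreover have "\<exists>x<m. \<exists>r<p. tail_op (x+1) f 0 r \<noteq> 0" using nz m by (intro exI[of _ "m-1"]) auto
    ultimately show False using pos1[of "\<lambda>x. tail_op (x+1) f 0"] by simp
  qed
qed

end

section \<open>The companion matrix and the passage from stability to positivity\<close>

locale monic_markov_polynomial = markov_polynomial +
  fixes n :: nat
  assumes n: "n = 2*m \<or> n = 2*m+1"
    and monic: "a n r c = (if r = c \<and> r < p then 1 else 0)"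
    and vanish: "n < i \<Longrightarrow> a i r c = 0"
    and even_S: "even n \<Longrightarrow> S r c = 0"
begin

lemma sum_even_odd: "tail_op 0 f 0 r + odd_op f 1 r = (\<Sum>i\<le>n. mv p (a i) (f i) r)"
proof -
  have "(\<Sum>k\<le>q. g (2*k)) + (\<Sum>k\<le>q. g (1+2*k)) = (\<Sum>i\<le>2*q+1. g i)" for q and g :: "nat \<Rightarrow> complex"
    by (induction q) (simp_all add: algebra_simps)
  note * = this[of "\<lambda>i. mv p (a i) (f i) r" m]
  have "tail_op 0 f 0 r + odd_op f 1 r = (\<Sum>i\<le>2*m+1. mv p (a i) (f i) r)"
    unfolding *[symmetric] by (simp add: tail_op_def odd_op_def atLeast0AtMost)
  also have "\<dots> = (\<Sum>i\<le>n. mv p (a i) (f i) r)"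
    using n by (intro sum.mono_neutral_right) (auto simp: mv_def vanish)
  finally show ?thesis .
qed

text \<open>This is \<open>F(-z)\<close>: if \<open>F f = 0\<close> and \<open>E f = 0\<close> at
  position 0, the sequence with alternating signs obeys the recurrence as well.\<close>

lemma sum_alternating: "tail_op 0 f 0 r - odd_op f 1 r = (\<Sum>i\<le>n. mv p (a i) (\<lambda>c. (-1)^i * f i c) r)"
  unfolding sum_even_odd[symmetric] by (simp add: tail_op_def odd_op_def mv_minus sum_negf)

lemma mv_monic: "r < p \<Longrightarrow> mv p (a n) v r = v r"
  by (simp add: mv_def monic if_distrib[of "\<lambda>x. x * _"] cong: if_cong)

text \<open>At \<open>i = n\<close> the value is the one that \<open>F f = 0\<close> prescribes for
  monic \<open>F\<close>.\<close>

definition block_seq :: "complex vec \<Rightarrow> nat \<Rightarrow> nat \<Rightarrow> complex" where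
  "block_seq x i r = (if i < n then x $ (i * p + r) else - (\<Sum>i<n. mv p (a i) (\<lambda>c. x $ (i * p + c)) r))"

definition companion :: "complex mat" where
  "companion = mat (n * p) (n * p) (\<lambda>(b,c). if b div p + 1 < n then (if c = b + p then 1 else 0)
     else - a (c div p) (b mod p) (c mod p))"

lemma companion_carrier: "companion \<in> carrier_mat (n * p) (n * p)"
  by (simp add: companion_def)

text \<open>On \<open>block_seq\<close> the companion matrix is the shift: upper block rows select
  the next block, the last one evaluates the recurrence.\<close>

lemma companion_mult:
  assumes x: "x \<in> carrier_vec (n * p)" and i: "i < n" and r: "r < p"
  shows "(companion *\<^sub>v x) $ (i * p + r) = block_seq x (i+1) r"
proof -
  have "(companion *\<^sub>v x) $ (i * p + r) = (\<Sum>c<n*p. companion $$ (i * p + r, c) * x $ c)"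
    using x block_index_less[OF i r]
    by (auto simp: scalar_prod_def companion_def lessThan_atLeast0 intro!: sum.cong)
  also have "\<dots> = block_seq x (i+1) r"
  proof (cases "i + 1 < n")
    case True
    have "(\<Sum>c<n*p. companion $$ (i * p + r, c) * x $ c) = (\<Sum>c<n*p. if c = (i+1)*p+r then x $ c else 0)"
      using True r block_index_less[OF i r]
      by (intro sum.cong) (auto simp: companion_def)
    then show ?thesis using True block_index_less[OF True r] by (simp add: block_seq_def)
  next
    case False
    have "(\<Sum>c<n*p. companion $$ (i * p + r, c) * x $ c) =
        (\<Sum>c<n*p. - a (c div p) r (c mod p) * x $ c)"
      using False r block_index_less[OF i r] by (intro sum.cong) (auto simp: companion_def)
    then show ?thesis using False
      by (simp add: sum_lessThan_mult block_seq_def mv_def sum_negf)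
  qed
  finally show ?thesis .
qed

lemma block_seq_recurrence: "r < p \<Longrightarrow> tail_op 0 (block_seq x) 0 r + odd_op (block_seq x) 1 r = 0"
  unfolding sum_even_odd lessThan_Suc_atMost[symmetric] sum.lessThan_Suc mv_monic
  by (simp add: block_seq_def[abs_def])

lemma tail_op_cong_lower:
  assumes "\<And>i r. i < n \<Longrightarrow> r < p \<Longrightarrow> f i r = g i r" "b \<ge> 1" "i \<le> 1"
  shows "tail_op b f i r = tail_op b g i r"
  unfolding tail_op_def
proof (intro sum.cong refl mv_cong assms(1))
  fix k assume "k \<in> {b..m}"
  then show "i + 2 * (k - b) < n" using assms n by auto
qed

lemma tail_op_0_cong:
  assumes "\<And>i r. i < n \<Longrightarrow> r < p \<Longrightarrow> f i r = g i r" "odd n"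
  shows "tail_op 0 f 0 r = tail_op 0 g 0 r"
  unfolding tail_op_def
proof (intro sum.cong refl mv_cong assms(1))
  fix k assume "k \<in> {0..m}"
  then show "0 + 2 * (k - 0) < n" using assms n by auto
qed

text \<open>Makes \<open>energy\<close> a form on the first \<open>n\<close> blocks. Tails from
  \<open>b \<ge> 1\<close> read indices up to \<open>1 + 2 * (m - 1)\<close>, below
  \<open>n\<close>; \<open>tail_op 0\<close> reads up to \<open>2 * m\<close>, which is below
  \<open>n\<close> for odd \<open>n\<close> and meets \<open>S = 0\<close> for even
  \<open>n\<close>.\<close>

lemma energy_cong:
  assumes f: "\<And>i r. i < n \<Longrightarrow> r < p \<Longrightarrow> f i r = f' i r" and g: "\<And>i r. i < n \<Longrightarrow> r < p \<Longrightarrow> g i r = g' i r"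
  shows "energy f g = energy f' g'"
proof -
  have 1: "ip p (tail_op 0 f 0) (mv p S (tail_op 0 g 0)) = ip p (tail_op 0 f' 0) (mv p S (tail_op 0 g' 0))"
  proof (cases "even n")
    case True
    then show ?thesis using even_S by (simp add: ip_def mv_def)
  next
    case False
    have "tail_op 0 f 0 = tail_op 0 f' 0" by (rule ext, rule tail_op_0_cong[OF f False])
    moreover have "tail_op 0 g 0 = tail_op 0 g' 0" by (rule ext, rule tail_op_0_cong[OF g False])
    ultimately show ?thesis by (simp only:)
  qed
  have 2: "tail_op (x+1) f i = tail_op (x+1) f' i" if "i \<le> 1" for x i
    by (rule ext, rule tail_op_cong_lower[OF f]) (use that in auto)
  have 3: "tail_op (x+1) g i = tail_op (x+1) g' i" if "i \<le> 1" for x i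
    by (rule ext, rule tail_op_cong_lower[OF g]) (use that in auto)
  show ?thesis
    unfolding energy_def 1 2[OF order_refl] 2[OF zero_le_one] 3[OF order_refl] 3[OF zero_le_one] ..
qed

lemma energy_tendsto_0:
  assumes f: "\<And>i r. i \<le> n \<Longrightarrow> r < p \<Longrightarrow> (\<lambda>k. f k i r) \<longlonglongrightarrow> 0"
  shows "(\<lambda>k. energy (f k) (f k)) \<longlonglongrightarrow> 0"
proof -
  have mv: "(\<lambda>k. mv p M (w k) r) \<longlonglongrightarrow> 0" if "\<And>r. r < p \<Longrightarrow> (\<lambda>k. w k r) \<longlonglongrightarrow> 0" for M w r
    unfolding mv_def using that by (intro tendsto_null_sum tendsto_mult_right_zero) auto
  have ip: "(\<lambda>k. ip p (v k) (w k)) \<longlonglongrightarrow> 0"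
    if "\<And>r. r < p \<Longrightarrow> (\<lambda>k. v k r) \<longlonglongrightarrow> 0" "\<And>r. r < p \<Longrightarrow> (\<lambda>k. w k r) \<longlonglongrightarrow> 0" for v w
    unfolding ip_def using that tendsto_cnj[of _ 0]
    by (intro tendsto_null_sum tendsto_mult_zero) auto
  have tail_op: "(\<lambda>k. tail_op b (f k) i r) \<longlonglongrightarrow> 0" if "i \<le> 2 * b" "i \<le> 1" for b i r
    unfolding tail_op_def using that n by (intro tendsto_null_sum mv f) auto
  have hf: "(\<lambda>k. hankel_form p m t d (\<lambda>x. tail_op (x+1) (f k) i) (\<lambda>x. tail_op (x+1) (f k) i)) \<longlonglongrightarrow> 0" if "i \<le> 1" for d i
    unfolding hankel_form_def using that by (intro tendsto_null_sum ip mv tail_op) auto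
  have "(\<lambda>k. energy (f k) (f k)) \<longlonglongrightarrow> 0 - 0 + 0"
    unfolding energy_def by (intro tendsto_intros hf ip mv tail_op) auto
  then show ?thesis by simp
qed

definition stable :: bool where
  "stable \<longleftrightarrow> (\<forall>\<nu> v. (\<exists>r<p. v r \<noteq> 0) \<longrightarrow> (\<forall>r<p. (\<Sum>i\<le>n. mv p (a i) (\<lambda>c. \<nu> ^ i * v c) r) = 0) \<longrightarrow> Re \<nu> < 0)"

lemma stableD:
  "stable \<Longrightarrow> \<exists>r<p. v r \<noteq> 0 \<Longrightarrow> (\<And>r. r < p \<Longrightarrow> (\<Sum>i\<le>n. mv p (a i) (\<lambda>c. \<nu> ^ i * v c) r) = 0) \<Longrightarrow> Re \<nu> < 0"
  unfolding stable_def by blast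

text \<open>An instance of \<open>lyapunov_positive\<close> for the companion matrix; the signs
  \<open>(-1) ^ (b div p)\<close> implement the reflection of \<open>z\<close> to
  \<open>- z\<close>.\<close>

lemma energy_pos_of_stable:
  assumes stable: "stable"
    and nz: "i < n" "r < p" "f i r \<noteq> 0"
  shows "Re (energy f f) > 0"
proof -
  define N where "N = n * p"
  define x where "x = vec N (\<lambda>b. f (b div p) (b mod p))"
  have sqx: "block_seq x i r = f i r" if "i < n" "r < p" for i r
    using that block_index_less[OF that] by (simp add: block_seq_def x_def N_def)
  have block_seq_add: "block_seq (y + z) i r = block_seq y i r + block_seq z i r" "block_seq (y - z) i r = block_seq y i r - block_seq z i r"
    if "y \<in> carrier_vec N" "z \<in> carrier_vec N" "i < n" "r < p" for y z i r
    using that block_index_less[OF that(3,4)] by (auto simp: block_seq_def N_def)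
  have sqC: "block_seq (companion *\<^sub>v y) i r = block_seq y (i+1) r" if "y \<in> carrier_vec N" "i < n" "r < p" for y i r
    using companion_mult[of y i r] that by (simp add: block_seq_def N_def)
  have eqI: "y = z" if "y \<in> carrier_vec N" "z \<in> carrier_vec N"
    "\<And>i r. i < n \<Longrightarrow> r < p \<Longrightarrow> block_seq y i r = block_seq z i r" for y z
  proof (rule eq_vecI)
    fix b assume "b < dim_vec z"
    then have "b < n * p" using that by (simp add: N_def)
    from that(3)[OF block_div_less[OF this]] block_div_less[OF this]
    show "y $ b = z $ b" by (simp add: block_seq_def)
  qed (use that in auto)
  \<comment> \<open>The factor 4 is that of \<open>Re_energy_polarization\<close>.\<close>
  define e where "e = (\<lambda>y. 4 * Re (ip p (tail_op 0 (block_seq y) 0) (tail_op 0 (block_seq y) 0)))"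
  have "Re (energy (block_seq x) (block_seq x)) > 0"
  proof (rule lyapunov_positive[where C = companion and N = N and e = e and \<sigma> = "\<lambda>b. (-1) ^ (b div p)"
        and q = "\<lambda>y. Re (energy (block_seq y) (block_seq y))"])
    show C: "companion \<in> carrier_mat N N" using companion_carrier by (simp add: N_def)
    show "Re \<nu> < 0" if "eigenvalue companion \<nu>" for \<nu>
    proof -
      from that obtain y where y: "y \<in> carrier_vec N" "y \<noteq> 0\<^sub>v N" "companion *\<^sub>v y = \<nu> \<cdot>\<^sub>v y"
        using C by (auto simp: eigenvalue_def eigenvector_def)
      have step: "block_seq y (i+1) r = \<nu> * block_seq y i r" if "i < n" "r < p" for i r
        using sqC[OF y(1) that] y that block_index_less[OF that] by (simp add: block_seq_def N_def)
      \<comment> \<open>An eigenvector of the companion matrix is geometric, and its block 0 is a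
        null vector of \<open>F(\<nu>)\<close>.\<close>
      have pow: "block_seq y i r = \<nu> ^ i * block_seq y 0 r" if "i \<le> n" "r < p" for i r
        using that by (induction i) (use step in \<open>auto simp: algebra_simps\<close>)
      show ?thesis
      proof (rule stableD[OF stable, where v = "block_seq y 0"])
        show "\<exists>r<p. block_seq y 0 r \<noteq> 0"
        proof (rule ccontr)
          assume "\<not> ?thesis"
          then have "block_seq y i r = 0" if "i < n" "r < p" for i r using pow[of i r] that by auto
          then have "y = 0\<^sub>v N" using y(1) block_index_less
            by (intro eqI) (auto simp: block_seq_def N_def)
          with y(2) show False by simp
        qed
        show "(\<Sum>i\<le>n. mv p (a i) (\<lambda>c. \<nu> ^ i * block_seq y 0 c) r) = 0" if "r < p" for r
        proof -
          note pow = pow[symmetric]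
          have "(\<Sum>i\<le>n. mv p (a i) (\<lambda>c. \<nu> ^ i * block_seq y 0 c) r) = (\<Sum>i\<le>n. mv p (a i) (block_seq y i) r)"
            by (intro sum.cong refl mv_cong) (simp add: pow)
          also have "\<dots> = 0" by (rule block_seq_recurrence[OF that, unfolded sum_even_odd])
          finally show ?thesis .
        qed
      qed
    qed
    show "Re (energy (block_seq (companion *\<^sub>v y + y)) (block_seq (companion *\<^sub>v y + y))) =
      Re (energy (block_seq (companion *\<^sub>v y - y)) (block_seq (companion *\<^sub>v y - y))) - e y" if y: "y \<in> carrier_vec N" for y
    proof -
      have Cy: "companion *\<^sub>v y \<in> carrier_vec N" using C y by simp
      let ?g = "\<lambda>i. block_seq y (i+1)"
      have "energy (block_seq (companion *\<^sub>v y + y)) (block_seq (companion *\<^sub>v y + y)) = energy (\<lambda>i r. ?g i r + block_seq y i r) (\<lambda>i r. ?g i r + block_seq y i r)"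
        by (intro energy_cong) (simp_all add: block_seq_add[OF Cy y] sqC[OF y])
      moreover have "energy (block_seq (companion *\<^sub>v y - y)) (block_seq (companion *\<^sub>v y - y)) = energy (\<lambda>i r. ?g i r - block_seq y i r) (\<lambda>i r. ?g i r - block_seq y i r)"
        by (intro energy_cong) (simp_all add: block_seq_add[OF Cy y] sqC[OF y])
      ultimately show ?thesis
        using Re_energy_polarization[of ?g "block_seq y"] lyapunov_identity[of "block_seq y"] block_seq_recurrence by (simp add: e_def)
    qed
    show "e y \<ge> 0" for y using Re_ip_self_nonneg by (simp add: e_def)
    show "(\<lambda>k. Re (energy (block_seq (y k)) (block_seq (y k)))) \<longlonglongrightarrow> 0"
      if y: "\<And>k. y k \<in> carrier_vec N" "\<And>i. i < N \<Longrightarrow> (\<lambda>k. y k $ i) \<longlonglongrightarrow> 0" for y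
    proof -
      have lim: "(\<lambda>k. y k $ (i * p + r)) \<longlonglongrightarrow> 0" if "i < n" "r < p" for i r
        using y(2)[of "i * p + r"] block_index_less[OF that] by (simp add: N_def)
      have "(\<lambda>k. block_seq (y k) i r) \<longlonglongrightarrow> 0" if r: "r < p" for i r
      proof (cases "i < n")
        case True
        then show ?thesis using lim[OF True r] by (simp add: block_seq_def)
      next
        case False
        have "(\<lambda>k. - (\<Sum>i<n. mv p (a i) (\<lambda>c. y k $ (i * p + c)) r)) \<longlonglongrightarrow> - 0"
          unfolding mv_def using lim by (intro tendsto_minus tendsto_null_sum tendsto_mult_right_zero) auto
        then show ?thesis using False by (simp add: block_seq_def)
      qed
      then have "(\<lambda>k. energy (block_seq (y k)) (block_seq (y k))) \<longlonglongrightarrow> 0" by (intro energy_tendsto_0)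
      from tendsto_Re[OF this] show ?thesis by simp
    qed
    show "companion *\<^sub>v vec (dim_vec y) (\<lambda>i. (-1) ^ (i div p) * y $ i) =
        - vec (dim_vec (companion *\<^sub>v y)) (\<lambda>i. (-1) ^ (i div p) * (companion *\<^sub>v y) $ i)"
      (is "_ *\<^sub>v ?Jy = ?R") if y: "y \<in> carrier_vec N" and ey: "e y = 0" for y
    proof -
      have Jy: "?Jy \<in> carrier_vec N" using y by auto
      have sJ: "block_seq ?Jy i r = (-1) ^ i * block_seq y i r" if "i < n" "r < p" for i r
        using that y block_index_less[OF that] by (simp add: block_seq_def N_def)
      have E0: "tail_op 0 (block_seq y) 0 r = 0" if "r < p" for r
        using ey that by (simp add: e_def Re_ip_self_eq_0_iff)
      \<comment> \<open>Block \<open>n\<close> is the one not read off from \<open>?Jy\<close>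
        directly. The recurrence of \<open>?Jy\<close> and the alternating one of \<open>y\<close>
        agree in the first \<open>n\<close> terms, hence in the last.\<close>
      have sn: "block_seq ?Jy n r = (-1) ^ n * block_seq y n r" if r: "r < p" for r
      proof -
        let ?A = "\<Sum>i<n. mv p (a i) (\<lambda>c. (-1)^i * block_seq y i c) r"
        have split: "(\<Sum>i\<le>n. mv p (a i) (f i) r) = (\<Sum>i<n. mv p (a i) (f i) r) + f n r" for f
          unfolding lessThan_Suc_atMost[symmetric] sum.lessThan_Suc mv_monic[OF r] ..
        have "(\<Sum>i\<le>n. mv p (a i) (\<lambda>c. (-1)^i * block_seq y i c) r) = 0"
          unfolding sum_alternating[symmetric] using block_seq_recurrence[OF r, of y] E0[OF r] by simp
        then have 1: "?A + (-1) ^ n * block_seq y n r = 0" unfolding split .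
        have "(\<Sum>i\<le>n. mv p (a i) (block_seq ?Jy i) r) = 0"
          by (rule block_seq_recurrence[OF r, unfolded sum_even_odd])
        moreover have "(\<Sum>i<n. mv p (a i) (block_seq ?Jy i) r) = ?A"
          using sJ by (intro sum.cong mv_cong) auto
        ultimately have "?A + block_seq ?Jy n r = 0" unfolding split by (simp only:)
        then have "?A + block_seq ?Jy n r = ?A + (-1) ^ n * block_seq y n r" unfolding 1 .
        then show ?thesis by (rule add_left_imp_eq)
      qed
      have sJ': "block_seq ?Jy (i+1) r = - ((-1) ^ i * block_seq y (i+1) r)" if "i < n" "r < p" for i r
        using sJ[of "i+1" r] sn[of r] that by (cases "i + 1 = n") auto
      show ?thesis
      proof (rule eqI)
        show "companion *\<^sub>v ?Jy \<in> carrier_vec N" using C Jy by simp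
        show "?R \<in> carrier_vec N" using C by simp
        fix i r assume ir: "i < n" "r < p"
        have "block_seq ?R i r = - ((-1) ^ i * block_seq (companion *\<^sub>v y) i r)"
          using ir y C block_index_less[OF ir] by (simp add: block_seq_def N_def del: index_mult_mat_vec)
        then show "block_seq (companion *\<^sub>v ?Jy) i r = block_seq ?R i r"
          using sqC[OF Jy ir] sqC[OF y ir] sJ'[OF ir] by simp
      qed
    qed
    show "(-1) ^ (i div p) \<noteq> (0::complex)" for i :: nat by simp
    show "x \<in> carrier_vec N" by (simp add: x_def)
    show "x \<noteq> 0\<^sub>v N"
    proof
      assume "x = 0\<^sub>v N"
      then have "block_seq x i r = 0" using nz block_index_less[OF nz(1,2)] by (simp add: block_seq_def N_def)
      then show False using sqx nz by simp
    qed
  qed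
  moreover have "energy (block_seq x) (block_seq x) = energy f f" by (intro energy_cong sqx)
  ultimately show ?thesis by simp
qed

text \<open>By \<open>tail_op_surj\<close> all but one of the three components of
  \<open>energy\<close> can be made 0, so its positivity passes to each form separately.\<close>

lemma forms_of_stable:
  assumes stable: "stable"
  shows "\<exists>x<m. \<exists>r<p. u x r \<noteq> 0 \<Longrightarrow> Re (hankel_form p m t 0 u u) > 0"
    and "\<exists>x<m. \<exists>r<p. u x r \<noteq> 0 \<Longrightarrow> Re (hankel_form p m t 1 u u) < 0"
    and "odd n \<Longrightarrow> \<exists>r<p. w r \<noteq> 0 \<Longrightarrow> Re (ip p w (mv p S w)) > 0"
proof -
  \<comment> \<open>If the first \<open>n\<close> blocks of \<open>f\<close> were all 0, then so
    would be every tail listed here.\<close>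
  have pos: "Re (energy f f) > 0" if nz: "\<exists>b r. 1 \<le> b \<and> r < p \<and> (tail_op b f 0 r \<noteq> 0 \<or> tail_op b f 1 r \<noteq> 0) \<or> odd n \<and> tail_op 0 f 0 r \<noteq> 0" for f
  proof (rule ccontr)
    assume neg: "\<not> ?thesis"
    have z: "f i r = 0" if "i < n" "r < p" for i r
    proof (rule ccontr)
      assume "f i r \<noteq> 0"
      have "Re (energy f f) > 0" by (rule energy_pos_of_stable[where f = f, OF stable that \<open>f i r \<noteq> 0\<close>])
      with neg show False by simp
    qed
    have 0: "tail_op b (\<lambda>i r. 0) i r = 0" for b i r by (simp add: tail_op_def mv_def)
    have 1: "tail_op b f i r = 0" if "b \<ge> 1" "i \<le> 1" for b i r
      using tail_op_cong_lower[where f = f and g = "\<lambda>i r. 0", OF z that] 0 by simp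
    have 2: "tail_op 0 f 0 r = 0" if "odd n" for r using tail_op_0_cong[where f = f and g = "\<lambda>i r. 0", OF z that] 0 by simp
    show False using nz 1[of _ 0] 1[of _ 1] 2 by blast
  qed
  have val: "energy f f = hankel_form p m t 0 (\<lambda>x. w' (x+1)) (\<lambda>x. w' (x+1))
      - hankel_form p m t 1 (\<lambda>x. w (x+1)) (\<lambda>x. w (x+1)) + ip p (w 0) (mv p S (w 0))"
    if f: "\<forall>b\<le>m. \<forall>r<p. tail_op b f 0 r = w b r" "\<forall>b\<le>m. \<forall>r<p. tail_op b f 1 r = w' b r" for f w w'
  proof -
    have "mv p S (tail_op 0 f 0) r = mv p S (w 0) r" for r using f by (intro mv_cong) auto
    then have "ip p (tail_op 0 f 0) (mv p S (tail_op 0 f 0)) = ip p (w 0) (mv p S (w 0))"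
      using f by (intro ip_cong) auto
    moreover have "hankel_form p m t d (\<lambda>x. tail_op (x+1) f 0) (\<lambda>x. tail_op (x+1) f 0) =
        hankel_form p m t d (\<lambda>x. w (x+1)) (\<lambda>x. w (x+1))" for d
      using f by (intro hankel_form_cong) auto
    moreover have "hankel_form p m t d (\<lambda>x. tail_op (x+1) f 1) (\<lambda>x. tail_op (x+1) f 1) =
        hankel_form p m t d (\<lambda>x. w' (x+1)) (\<lambda>x. w' (x+1))" for d
      using f by (intro hankel_form_cong) auto
    ultimately show ?thesis unfolding energy_def by (simp only:)
  qed
  have z: "hankel_form p m t d (\<lambda>x r. 0) (\<lambda>x r. 0) = 0" for d by (rule hankel_form_zero) simp
  have z': "ip p (\<lambda>r. 0) v = 0" for v by (simp add: ip_def)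
  show "Re (hankel_form p m t 0 u u) > 0" if u: "\<exists>x<m. \<exists>r<p. u x r \<noteq> 0"
  proof -
    obtain f where f: "\<forall>b\<le>m. \<forall>r<p. tail_op b f 0 r = (\<lambda>_ _. 0) b r" "\<forall>b\<le>m. \<forall>r<p. tail_op b f 1 r = (\<lambda>b. u (b-1)) b r"
      using tail_op_surj[of "\<lambda>_ _. 0" "\<lambda>b. u (b-1)"] by blast
    from u obtain x r where xr: "x < m" "r < p" "u x r \<noteq> 0" by blast
    have "tail_op (x+1) f 1 r \<noteq> 0" using f(2) xr by simp
    then have "Re (energy f f) > 0" using xr by (intro pos exI[of _ "x+1"] exI[of _ r]) simp
    then show ?thesis unfolding val[OF f] by (simp add: z z')
  qed
  show "Re (hankel_form p m t 1 u u) < 0" if u: "\<exists>x<m. \<exists>r<p. u x r \<noteq> 0"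
  proof -
    obtain f where f: "\<forall>b\<le>m. \<forall>r<p. tail_op b f 0 r = (\<lambda>b r. if b = 0 then 0 else u (b-1) r) b r" "\<forall>b\<le>m. \<forall>r<p. tail_op b f 1 r = (\<lambda>_ _. 0) b r"
      using tail_op_surj[of "\<lambda>b r. if b = 0 then 0 else u (b-1) r" "\<lambda>_ _. 0"] by blast
    from u obtain x r where xr: "x < m" "r < p" "u x r \<noteq> 0" by blast
    have "tail_op (x+1) f 0 r \<noteq> 0" using f(1) xr by simp
    then have "Re (energy f f) > 0" using xr by (intro pos exI[of _ "x+1"] exI[of _ r]) simp
    then show ?thesis unfolding val[OF f] by (simp add: z z')
  qed
  show "Re (ip p w (mv p S w)) > 0" if "odd n" and w: "\<exists>r<p. w r \<noteq> 0"
  proof -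
    obtain f where f: "\<forall>b\<le>m. \<forall>r<p. tail_op b f 0 r = (\<lambda>b r. if b = 0 then w r else 0) b r" "\<forall>b\<le>m. \<forall>r<p. tail_op b f 1 r = (\<lambda>_ _. 0) b r"
      using tail_op_surj[of "\<lambda>b r. if b = 0 then w r else 0" "\<lambda>_ _. 0"] by blast
    from w obtain r where r: "r < p" "w r \<noteq> 0" by blast
    have "Re (energy f f) > 0" using r f(1) \<open>odd n\<close> by (intro pos exI[of _ 0] exI[of _ r]) simp
    then show ?thesis unfolding val[OF f] by (simp add: z)
  qed
qed

end

subsection \<open>Matrices and Markov parameters\<close>

text \<open>The value 0 outside the range lets the identities demanded by the locales hold for all
  indices.\<close>

definition entry :: "nat \<Rightarrow> complex mat \<Rightarrow> nat \<Rightarrow> nat \<Rightarrow> complex" where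
  "entry p M r c = (if r < p \<and> c < p then M $$ (r,c) else 0)"

lemma mult_mat_vec_entry:
  assumes "M \<in> carrier_mat p p" "v \<in> carrier_vec p" "r < p"
  shows "(M *\<^sub>v v) $ r = mv p (entry p M) (\<lambda>c. v $ c) r"
  using assms by (auto simp: mv_def entry_def scalar_prod_def lessThan_atLeast0 intro!: sum.cong)

lemma hermitian_mat_entry:
  assumes "hermitian_mat M" "M \<in> carrier_mat p p"
  shows "entry p M c r = cnj (entry p M r c)"
proof -
  have "M $$ (c,r) = cnj (M $$ (r,c))" if "r < p" "c < p"
    using assms that unfolding hermitian_mat_def by blast
  then show ?thesis by (simp add: entry_def)
qed

lemma pos_def_mat_entry:
  assumes M: "M \<in> carrier_mat p p" and herm: "hermitian_mat M"
  shows "pos_def_mat M \<longleftrightarrow> (\<forall>w. (\<exists>r<p. w r \<noteq> 0) \<longrightarrow> 0 < Re (ip p w (mv p (entry p M) w)))"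
proof -
  have "(\<Sum>i<p. \<Sum>j<p. cnj (w i) * M $$ (i,j) * w j) = ip p w (mv p (entry p M) w)" for w
    by (simp add: ip_def mv_def entry_def sum_distrib_left mult.assoc)
  then show ?thesis using M herm by (simp add: pos_def_mat_def)
qed

text \<open>The sign \<open>(-1) ^ (d + y + z)\<close> inside \<open>t\<close> is cancelled by the
  alternating signs of the two block vectors together with \<open>(-1) ^ d\<close>.\<close>

lemma block_hankel_form:
  assumes t: "\<And>k r c. t k r c = (-1) ^ k * entry p (s k) r c"
  shows "(\<Sum>i<m*p. \<Sum>j<m*p. cnj (x i) * block_hankel p s d m $$ (i,j) * x j) =
     (-1) ^ d * hankel_form p m t d (\<lambda>y r. (-1) ^ y * x (y * p + r)) (\<lambda>y r. (-1) ^ y * x (y * p + r))"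
proof -
  have "(\<Sum>i<m*p. \<Sum>j<m*p. cnj (x i) * block_hankel p s d m $$ (i,j) * x j) =
     (\<Sum>y<m. \<Sum>r<p. \<Sum>z<m. \<Sum>c<p. cnj (x (y*p+r)) * s (d + y + z) $$ (r,c) * x (z*p+c))"
    unfolding sum_lessThan_mult
  proof (intro sum.cong refl)
    fix y r z c assume "y \<in> {..<m}" "r \<in> {..<p}" "z \<in> {..<m}" "c \<in> {..<p}"
    then show "cnj (x (y*p+r)) * block_hankel p s d m $$ (y*p+r, z*p+c) * x (z*p+c) =
        cnj (x (y*p+r)) * s (d + y + z) $$ (r,c) * x (z*p+c)"
      using block_index_less[of y m r p] block_index_less[of z m c p] by (simp add: block_hankel_def)
  qed
  also have "\<dots> = (\<Sum>y<m. \<Sum>z<m. \<Sum>r<p. \<Sum>c<p. cnj (x (y*p+r)) * s (d + y + z) $$ (r,c) * x (z*p+c))"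
    by (rule sum.cong[OF refl], rule sum.swap)
  also have "\<dots> = (-1) ^ d * hankel_form p m t d (\<lambda>y r. (-1) ^ y * x (y * p + r)) (\<lambda>y r. (-1) ^ y * x (y * p + r))"
    unfolding hankel_form_def ip_def mv_def sum_distrib_left
  proof (intro sum.cong refl)
    fix y z r c assume "r \<in> {..<p}" "c \<in> {..<p}"
    then have "(-1) ^ d * (cnj ((-1) ^ y * x (y*p+r)) * (t (d + y + z) r c * ((-1) ^ z * x (z*p+c)))) =
        (-1) ^ d * ((-1) ^ y * ((-1) ^ (d + y + z) * (-1) ^ z)) *
        (cnj (x (y*p+r)) * s (d + y + z) $$ (r,c) * x (z*p+c))"
      by (simp add: t entry_def)
    also have "(-1) ^ d * ((-1) ^ y * ((-1) ^ (d + y + z) * (-1) ^ z)) =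
        (-1 :: complex) ^ (d + (y + ((d + y + z) + z)))"
      by (simp only: power_add)
    also have "d + (y + ((d + y + z) + z)) = 2 * (d + y + z)" by simp
    finally show "cnj (x (y*p+r)) * s (d + y + z) $$ (r,c) * x (z*p+c) =
        (-1) ^ d * (cnj ((-1) ^ y * x (y*p+r)) * (t (d + y + z) r c * ((-1) ^ z * x (z*p+c))))"
      by (simp only: power_minus1_even mult_1)
  qed
  finally show ?thesis .
qed

text \<open>Flattening with alternating signs matches block vectors \<open>u\<close> with vectors
  \<open>x\<close> on the relevant indices, and nonzero ones with nonzero ones.\<close>

lemma pos_def_block_hankel:
  assumes t: "\<And>k r c. t k r c = (-1) ^ k * entry p (s k) r c"
    and s: "\<And>k. s k \<in> carrier_mat p p" and herm: "\<And>k. k < 2 * m \<Longrightarrow> hermitian_mat (s k)" and d: "d \<le> 1"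
  shows "pos_def_mat (block_hankel p s d m) \<longleftrightarrow>
    (\<forall>u. (\<exists>x<m. \<exists>r<p. u x r \<noteq> 0) \<longrightarrow> 0 < Re ((-1) ^ d * hankel_form p m t d u u))"
proof -
  have dims: "dim_row (block_hankel p s d m) = m * p" by (simp add: block_hankel_def)
  have "hermitian_mat (block_hankel p s d m)"
    unfolding hermitian_mat_def
  proof (intro conjI allI impI)
    fix i j assume "i < dim_row (block_hankel p s d m)" "j < dim_row (block_hankel p s d m)"
    then have ij: "i < m * p" "j < m * p" by (simp_all add: block_hankel_def)
    note dm = block_div_less[OF ij(1)] block_div_less[OF ij(2)]
    have "d + i div p + j div p < 2 * m" using dm d by simp
    from hermitian_mat_entry[OF herm[OF this] s, of "i mod p" "j mod p"]
    have "s (d + i div p + j div p) $$ (i mod p, j mod p) =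
        cnj (s (d + i div p + j div p) $$ (j mod p, i mod p))"
      using dm by (simp only: entry_def) simp
    then show "block_hankel p s d m $$ (i,j) = cnj (block_hankel p s d m $$ (j,i))"
      using ij by (simp add: block_hankel_def add.commute add.left_commute)
  qed (simp add: block_hankel_def)
  then have "pos_def_mat (block_hankel p s d m) \<longleftrightarrow> (\<forall>x. (\<exists>i<m*p. x i \<noteq> 0) \<longrightarrow>
      0 < Re ((-1) ^ d * hankel_form p m t d (\<lambda>y r. (-1) ^ y * x (y * p + r)) (\<lambda>y r. (-1) ^ y * x (y * p + r))))"
    unfolding pos_def_mat_def dims block_hankel_form[OF t] by simp
  also have "\<dots> \<longleftrightarrow> (\<forall>u. (\<exists>x<m. \<exists>r<p. u x r \<noteq> 0) \<longrightarrow> 0 < Re ((-1) ^ d * hankel_form p m t d u u))"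
    (is "(\<forall>x. ?L x) \<longleftrightarrow> (\<forall>u. ?R u)")
  proof (intro iffI allI impI)
    fix u :: "nat \<Rightarrow> nat \<Rightarrow> complex"
    assume L: "\<forall>x. ?L x" and "\<exists>y<m. \<exists>r<p. u y r \<noteq> 0"
    then obtain y r where yr: "y < m" "r < p" "u y r \<noteq> 0" by blast
    define x where "x = (\<lambda>b. (-1) ^ (b div p) * u (b div p) (b mod p))"
    have "x (y * p + r) \<noteq> 0" using yr by (simp add: x_def)
    then have "\<exists>i<m*p. x i \<noteq> 0" using block_index_less[OF yr(1,2)] by blast
    moreover have "hankel_form p m t d (\<lambda>y r. (-1) ^ y * x (y * p + r)) (\<lambda>y r. (-1) ^ y * x (y * p + r)) =
        hankel_form p m t d u u"
      by (intro hankel_form_cong) (simp_all add: x_def flip: mult.assoc power_mult_distrib)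
    ultimately show "0 < Re ((-1) ^ d * hankel_form p m t d u u)" using L[rule_format, of x] by (simp only:)
  next
    fix x :: "nat \<Rightarrow> complex"
    assume R: "\<forall>u. ?R u" and "\<exists>i<m*p. x i \<noteq> 0"
    then obtain i where i: "i < m * p" "x i \<noteq> 0" by blast
    have "x (i div p * p + i mod p) \<noteq> 0" using i by simp
    then have "\<exists>y<m. \<exists>r<p. (-1) ^ y * x (y * p + r) \<noteq> 0"
      using block_div_less[OF i(1)] by (intro exI[of _ "i div p"] conjI exI[of _ "i mod p"]) simp_all
    then show "0 < Re ((-1) ^ d * hankel_form p m t d (\<lambda>y r. (-1) ^ y * x (y * p + r)) (\<lambda>y r. (-1) ^ y * x (y * p + r)))"
      by (rule R[rule_format])
  qed
  finally show ?thesis .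
qed

section \<open>Coefficients of \<open>F\<close>, its even and odd parts, and their Markov
  relations\<close>

text \<open>The coefficient of \<open>z\<^sup>i\<close>, since \<open>A k\<close> belongs to \<open>z\<^bsup>n-k\<^esup>\<close>.\<close>
definition coeff_rev :: "nat \<Rightarrow> nat \<Rightarrow> (nat \<Rightarrow> complex mat) \<Rightarrow> nat \<Rightarrow> nat \<Rightarrow> nat \<Rightarrow> complex" where
  "coeff_rev p n A i r c = (if i \<le> n then entry p (A (n - i)) r c else 0)"

lemma sum_rev: "(\<Sum>k\<le>m. g k) = (\<Sum>k\<le>m. g (m - k))" for g :: "nat \<Rightarrow> complex"
  by (rule sum.reindex_bij_witness[of _ "\<lambda>k. m - k" "\<lambda>k. m - k"]) auto

text \<open>A square matrix is singular iff it has a nonzero null vector; this gives the form of the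
  predicate \<open>stable\<close>.\<close>

lemma hurwitz_stable_Fpoly:
  "hurwitz_stable (Fpoly p n A) \<longleftrightarrow> (\<forall>\<nu> v. (\<exists>r<p. v r \<noteq> 0) \<longrightarrow>
     (\<forall>r<p. (\<Sum>i\<le>n. mv p (coeff_rev p n A i) (\<lambda>c. \<nu> ^ i * v c) r) = 0) \<longrightarrow> Re \<nu> < 0)"
proof -
  have F: "Fpoly p n A z \<in> carrier_mat p p" for z by (simp add: Fpoly_def mpoly_eval_def)
  have Fv: "(Fpoly p n A z *\<^sub>v v) $ r = (\<Sum>i\<le>n. mv p (coeff_rev p n A i) (\<lambda>c. z ^ i * v $ c) r)"
    if v: "v \<in> carrier_vec p" and r: "r < p" for z v r
  proof -
    have "(Fpoly p n A z *\<^sub>v v) $ r = (\<Sum>c<p. (\<Sum>k\<le>n. A k $$ (r,c) * z ^ (n - k)) * v $ c)"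
      unfolding mult_mat_vec_entry[OF F v r] mv_def using r
      by (intro sum.cong) (simp_all add: entry_def Fpoly_def mpoly_eval_def)
    also have "\<dots> = (\<Sum>c<p. \<Sum>i\<le>n. coeff_rev p n A i r c * (z ^ i * v $ c))"
      unfolding sum_distrib_right by (subst sum_rev) (use r in \<open>simp add: coeff_rev_def entry_def mult.assoc\<close>)
    also have "\<dots> = (\<Sum>i\<le>n. mv p (coeff_rev p n A i) (\<lambda>c. z ^ i * v $ c) r)"
      unfolding mv_def by (rule sum.swap)
    finally show ?thesis .
  qed
  have vec_eq_0: "v = 0\<^sub>v p \<longleftrightarrow> (\<forall>r<p. v $ r = 0)" if "v \<in> carrier_vec p" for v :: "complex vec"
    using that by auto
  have "det (Fpoly p n A z) = 0 \<longleftrightarrow> (\<exists>v. (\<exists>r<p. v r \<noteq> 0) \<and>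
     (\<forall>r<p. (\<Sum>i\<le>n. mv p (coeff_rev p n A i) (\<lambda>c. z ^ i * v c) r) = 0))" (is "_ \<longleftrightarrow> (\<exists>v. ?P v)") for z
  proof
    assume "det (Fpoly p n A z) = 0"
    then obtain v where v: "v \<in> carrier_vec p" "v \<noteq> 0\<^sub>v p" "Fpoly p n A z *\<^sub>v v = 0\<^sub>v p"
      unfolding det_0_iff_vec_prod_zero[OF F] by blast
    have "(\<Sum>i\<le>n. mv p (coeff_rev p n A i) (\<lambda>c. z ^ i * v $ c) r) = 0" if "r < p" for r
      using Fv[OF v(1) that, of z] v(3) that by simp
    then have "?P (\<lambda>c. v $ c)" using v vec_eq_0 by blast
    then show "\<exists>v. ?P v" by (rule exI[where P = ?P])
  next
    assume "\<exists>v. ?P v"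
    then obtain v where v: "?P v" ..
    define x where "x = vec p v"
    have x: "x \<in> carrier_vec p" by (simp add: x_def)
    have "(\<Sum>i\<le>n. mv p (coeff_rev p n A i) (\<lambda>c. z ^ i * x $ c) r) =
        (\<Sum>i\<le>n. mv p (coeff_rev p n A i) (\<lambda>c. z ^ i * v c) r)" for r
      by (intro sum.cong refl mv_cong) (simp add: x_def)
    then have "(Fpoly p n A z *\<^sub>v x) $ r = 0" if "r < p" for r using Fv[OF x that] v that by simp
    moreover have "Fpoly p n A z *\<^sub>v x \<in> carrier_vec p" by (rule mult_mat_vec_carrier[OF F x])
    ultimately have "Fpoly p n A z *\<^sub>v x = 0\<^sub>v p" using vec_eq_0 by blast
    moreover have "x \<noteq> 0\<^sub>v p" using v vec_eq_0[OF x] by (auto simp: x_def)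
    ultimately show "det (Fpoly p n A z) = 0"
      unfolding det_0_iff_vec_prod_zero[OF F] using x by blast
  qed
  then show ?thesis unfolding hurwitz_stable_def by blast
qed

text \<open>Counting coefficients from the constant term gives one formula for both parities of
  \<open>n\<close>.\<close>

lemma Feven_entry:
  assumes "r < p" "c < p"
  shows "Feven p n A z $$ (r,c) = (\<Sum>k\<le>n div 2. coeff_rev p n A (2*k) r c * z ^ k)"
proof (cases "even n")
  case True
  then have "n - 2 * k = 2 * (n div 2 - k)" for k by auto
  then show ?thesis using assms True
    by (simp add: Feven_def mpoly_eval_def) (subst sum_rev, auto simp: coeff_rev_def entry_def intro!: sum.cong)
next
  case False
  then have "n - 2 * k = 2 * (n div 2 - k) + 1" if "k \<le> n div 2" for k using that by presburger
  then show ?thesis using assms False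
    by (simp add: Feven_def mpoly_eval_def) (subst sum_rev, auto simp: coeff_rev_def entry_def intro!: sum.cong)
qed

lemma Fodd_entry:
  assumes "r < p" "c < p"
  shows "Fodd p n A z $$ (r,c) = (\<Sum>k\<le>n div 2. coeff_rev p n A (2*k+1) r c * z ^ k)"
proof (cases "even n")
  case True
  have "Fodd p n A z $$ (r,c) = (\<Sum>k\<in>{1..n div 2}. A (2*k-1) $$ (r,c) * z ^ (n div 2 - k))"
    using assms True by (simp add: Fodd_def)
  also have "\<dots> = (\<Sum>k<n div 2. coeff_rev p n A (2*k+1) r c * z ^ k)"
  proof (rule sum.reindex_bij_witness[of _ "\<lambda>k. n div 2 - k" "\<lambda>k. n div 2 - k"])
    fix k assume "k \<in> {1..n div 2}"
    then have "2 * (n div 2 - k) + 1 \<le> n" "n - (2 * (n div 2 - k) + 1) = 2 * k - 1" using True by auto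
    then show "coeff_rev p n A (2 * (n div 2 - k) + 1) r c * z ^ (n div 2 - k) = A (2*k-1) $$ (r,c) * z ^ (n div 2 - k)"
      using assms by (simp only: coeff_rev_def entry_def) simp
  qed auto
  \<comment> \<open>The added term has coefficient index \<open>n + 1\<close>, where
    \<open>coeff_rev\<close> is 0.\<close>
  also have "\<dots> = (\<Sum>k\<le>n div 2. coeff_rev p n A (2*k+1) r c * z ^ k)"
    using True by (simp add: lessThan_Suc_atMost[symmetric] coeff_rev_def)
  finally show ?thesis .
next
  case False
  then have "n - (2 * k + 1) = 2 * (n div 2 - k)" if "k \<le> n div 2" for k using that by presburger
  moreover have "2 * k + 1 \<le> n" if "k \<le> n div 2" for k using that False by presburger
  ultimately show ?thesis using assms False
    by (simp add: Fodd_def mpoly_eval_def) (subst sum_rev, auto simp: coeff_rev_def entry_def intro!: sum.cong)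
qed

lemma mat_inv:
  assumes "invertible_mat M" "M \<in> carrier_mat p p"
  shows "mat_inv M \<in> carrier_mat p p" "mat_inv M * M = 1\<^sub>m p"
proof -
  obtain B where B: "inverts_mat M B" "inverts_mat B M" using assms by (auto simp: invertible_mat_def)
  have "M * B = 1\<^sub>m p" "B * M = 1\<^sub>m (dim_row B)" using B assms by (auto simp: inverts_mat_def)
  moreover from this have "B \<in> carrier_mat p p"
    using assms by (metis carrier_matD carrier_matI index_mult_mat(2,3) index_one_mat(2,3))
  ultimately have "\<exists>B. B \<in> carrier_mat (dim_row M) (dim_row M) \<and> M * B = 1\<^sub>m (dim_row M) \<and> B * M = 1\<^sub>m (dim_row M)"
    using assms by auto
  from someI_ex[OF this] show "mat_inv M \<in> carrier_mat p p" "mat_inv M * M = 1\<^sub>m p"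
    using assms by (auto simp: mat_inv_def)
qed

text \<open>Multiply the expansion of \<open>O E^-1\<close> by \<open>E\<close> and compare
  coefficients with \<open>O\<close>, one entry \<open>(r,c)\<close> at a time; \<open>S\<close> is
  the value at infinity.\<close>

lemma markov_relations:
  fixes A s :: "nat \<Rightarrow> complex mat" and S :: "nat \<Rightarrow> nat \<Rightarrow> complex" and p n :: nat
  defines "a \<equiv> coeff_rev p n A" and "t \<equiv> \<lambda>k r c. (-1) ^ k * entry p (s k) r c" and "m \<equiv> n div 2"
  assumes S: "\<And>r c. \<not> (r < p \<and> c < p) \<Longrightarrow> S r c = 0"
    and markov: "\<And>z. R < norm z \<Longrightarrow> invertible_mat (Feven p n A z) \<and>
        (\<forall>i<p. \<forall>j<p. (\<lambda>k. (-1)^k / z^(k+1) * s k $$ (i,j)) sums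
             ((Fodd p n A z * mat_inv (Feven p n A z)) $$ (i,j) - S i j))"
  shows "j \<le> m \<Longrightarrow>
      a (2*j+1) r c = mm p S (a (2*j)) r c + (\<Sum>k\<in>{j<..m}. mm p (t (k-j-1)) (a (2*k)) r c)"
    and "(\<Sum>k\<le>m. mm p (t (j+k)) (a (2*k)) r c) = 0"
proof -
  have "(j \<le> m \<longrightarrow> a (2*j+1) r c = mm p S (a (2*j)) r c + (\<Sum>k\<in>{j<..m}. mm p (t (k-j-1)) (a (2*k)) r c))
    \<and> (\<Sum>k\<le>m. mm p (t (j+k)) (a (2*k)) r c) = 0"
  proof (cases "r < p \<and> c < p")
    case False
    then show ?thesis using S
      by (auto simp: mm_def a_def t_def coeff_rev_def entry_def)
  next
    case True
    define G where "G = (\<lambda>z. Fodd p n A z * mat_inv (Feven p n A z))"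
    have Fe: "Feven p n A z \<in> carrier_mat p p" and Fo: "Fodd p n A z \<in> carrier_mat p p" for z
      by (auto simp: Feven_def Fodd_def mpoly_eval_def)
    have sums: "(\<lambda>k. t k r l / z ^ (k + 1)) sums (G z $$ (r,l) - S r l)" if "R < norm z" "l < p" for z l
      using markov[OF that(1)] True that(2) by (simp add: t_def entry_def G_def)
    have eq: "(\<Sum>k\<le>m. a (2*k+1) r c * z ^ k) = (\<Sum>l<p. G z $$ (r,l) * (\<Sum>k\<le>m. a (2*k) l c * z ^ k))"
      if z: "R < norm z" for z
    proof -
      from markov[OF z] have inv: "invertible_mat (Feven p n A z)" by blast
      note I = mat_inv[OF inv Fe]
      have "Fodd p n A z = G z * Feven p n A z"
        unfolding G_def using I Fo Fe by (simp add: assoc_mult_mat[of _ p p _ p _ p] right_mult_one_mat[of _ p p])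
      moreover have "G z \<in> carrier_mat p p" unfolding G_def by (rule mult_carrier_mat[OF Fo I(1)])
      ultimately have "Fodd p n A z $$ (r,c) = (\<Sum>l<p. G z $$ (r,l) * Feven p n A z $$ (l,c))"
        using True Fe[of z] by (auto simp: scalar_prod_def lessThan_atLeast0 intro!: sum.cong)
      then show ?thesis using True by (simp add: Fodd_entry Feven_entry a_def m_def)
    qed
    note coeffs = laurent_coeffs[where R = R and p = p and t = "\<lambda>l k. t k r l" and w = "S r" and m = m and j = j
        and g = "\<lambda>l z. G z $$ (r,l)" and od = "\<lambda>k. a (2*k+1) r c" and e = "\<lambda>l k. a (2*k) l c"]
    have rel1: "a (2*j+1) r c = (\<Sum>l<p. \<Sum>k\<in>{j..m}.
        (if k - j = 0 then S r l else t (k - j - 1) r l) * a (2*k) l c)" if "j \<le> m"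
      by (rule coeffs(1)) (rule sums, assumption, assumption, erule eq, rule that)
    have rel2: "(\<Sum>l<p. \<Sum>k\<le>m. (if j + k + 1 = 0 then S r l else t (j + k + 1 - 1) r l) * a (2*k) l c) = 0"
      by (rule coeffs(2)) (rule sums, assumption, assumption, erule eq)
    have "(\<Sum>k\<le>m. mm p (t (j+k)) (a (2*k)) r c) = 0"
      unfolding mm_def using rel2 by (subst sum.swap) simp
    moreover have "a (2*j+1) r c = mm p S (a (2*j)) r c + (\<Sum>k\<in>{j<..m}. mm p (t (k-j-1)) (a (2*k)) r c)"
      if j: "j \<le> m"
    proof -
      have "a (2*j+1) r c = (\<Sum>k\<in>{j..m}. \<Sum>l<p. (if k - j = 0 then S r l else t (k - j - 1) r l) * a (2*k) l c)"
        unfolding rel1[OF j] by (rule sum.swap)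
      also have "\<dots> = mm p S (a (2*j)) r c + (\<Sum>k\<in>{j<..m}. mm p (t (k-j-1)) (a (2*k)) r c)"
        using j by (simp add: sum.head mm_def)
      finally show ?thesis .
    qed
    ultimately show ?thesis by blast
  qed
  then show "j \<le> m \<Longrightarrow>
      a (2*j+1) r c = mm p S (a (2*j)) r c + (\<Sum>k\<in>{j<..m}. mm p (t (k-j-1)) (a (2*k)) r c)"
    and "(\<Sum>k\<le>m. mm p (t (j+k)) (a (2*k)) r c) = 0" by blast+
qed

text \<open>A one-sided inverse of a square matrix is two-sided.\<close>

lemma mm_one_imp_inverse:
  assumes "\<And>r c. r < p \<Longrightarrow> c < p \<Longrightarrow> mm p S M r c = (if r = c then 1 else 0)" "r < p"
  shows "mv p S (mv p M v) r = v r" "mv p M (mv p S v) r = v r"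
proof -
  have one: "mv p (mm p X Y) v r = v r"
    if "\<And>r c. r < p \<Longrightarrow> c < p \<Longrightarrow> mm p X Y r c = (if r = c then 1 else 0)" for X Y
  proof -
    have "mv p (mm p X Y) v r = (\<Sum>c<p. if r = c then v c else 0)"
      unfolding mv_def using that[OF assms(2)] by (intro sum.cong) auto
    then show ?thesis using assms(2) by simp
  qed
  define X where "X = mat p p (\<lambda>(r,c). S r c)"
  define Y where "Y = mat p p (\<lambda>(r,c). M r c)"
  have XY: "X \<in> carrier_mat p p" "Y \<in> carrier_mat p p" by (simp_all add: X_def Y_def)
  have "X * Y = 1\<^sub>m p"
    using assms(1) by (intro eq_matI) (auto simp: X_def Y_def scalar_prod_def mm_def lessThan_atLeast0)
  then have YX: "Y * X = 1\<^sub>m p" by (rule mat_mult_left_right_inverse[OF XY])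
  have "mm p M S r c = (if r = c then 1 else 0)" if "r < p" "c < p" for r c
    using arg_cong[OF YX, of "\<lambda>M. M $$ (r,c)"] that
    by (simp add: X_def Y_def scalar_prod_def mm_def lessThan_atLeast0)
  from one[OF this] one[OF assms(1)]
  show "mv p S (mv p M v) r = v r" "mv p M (mv p S v) r = v r" by (simp_all add: mv_mm)
qed

section \<open>The stability criterion for both parities of \<open>n\<close>\<close>

theorem theorem4p9:
  fixes p n m :: nat and A :: "nat \<Rightarrow> complex mat"
    and s :: "nat \<Rightarrow> complex mat" and sm1 :: "complex mat"
  assumes m_def: "m = n div 2"
    and coeffs: "\<forall>k\<le>n. A k \<in> carrier_mat p p"
    and monic: "A 0 = 1\<^sub>m p"
    and regular: "odd n \<Longrightarrow> (\<exists>z. det (Feven p n A z) \<noteq> 0)"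
    and markov_even: "even n \<Longrightarrow> right_markov p n A s"
    and markov_odd: "odd n \<Longrightarrow> right_markov_first p n A sm1 s"
    and herm: "\<forall>k<2*m. hermitian_mat (s k)"
    and herm_m1: "odd n \<Longrightarrow> hermitian_mat sm1"
  shows "hurwitz_stable (Fpoly p n A) \<longleftrightarrow>
           pos_def_mat (block_hankel p s 0 m) \<and> pos_def_mat (block_hankel p s 1 m)
           \<and> (odd n \<longrightarrow> pos_def_mat sm1)"
proof -
  define a where "a = coeff_rev p n A"
  define t where "t = (\<lambda>k r c. (-1) ^ k * entry p (s k) r c)"
  \<comment> \<open>Setting \<open>S = 0\<close> for even \<open>n\<close> turns both kinds of
    Markov parameters into one expansion.\<close>
  define S where "S = (\<lambda>r c. if odd n then entry p sm1 r c else 0)"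
  have S_odd: "odd n \<Longrightarrow> S = entry p sm1" and S_even: "even n \<Longrightarrow> S r c = 0" for r c
    by (auto simp: S_def)
  have s: "s k \<in> carrier_mat p p" for k
    using markov_even markov_odd by (cases "even n") (auto simp: right_markov_def right_markov_first_def)
  have sm1: "sm1 \<in> carrier_mat p p" if "odd n"
    using markov_odd[OF that] by (simp add: right_markov_first_def)
  obtain R where R: "\<And>z. R < norm z \<Longrightarrow> invertible_mat (Feven p n A z) \<and>
        (\<forall>i<p. \<forall>j<p. (\<lambda>k. (-1)^k / z^(k+1) * s k $$ (i,j)) sums
             ((Fodd p n A z * mat_inv (Feven p n A z)) $$ (i,j) - S i j))"
  proof (cases "even n")
    case True
    then show ?thesis using markov_even[OF True] that S_even[OF True] by (auto simp: right_markov_def)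
  next
    case False
    then have "S i j = sm1 $$ (i,j)" if "i < p" "j < p" for i j using that by (simp add: S_odd entry_def)
    then show ?thesis using markov_odd[OF False] that by (auto simp: right_markov_first_def)
  qed
  have S0: "S r c = 0" if "\<not> (r < p \<and> c < p)" for r c using that by (auto simp: S_def entry_def)
  have rel: "a (2*j+1) r c = mm p S (a (2*j)) r c + (\<Sum>k\<in>{j<..m}. mm p (t (k-j-1)) (a (2*k)) r c)"
    if "j \<le> m" for j r c
    using that unfolding a_def t_def m_def
    by (rule markov_relations(1)[where R = R, rotated 2]) (erule S0, erule R)
  have rel': "(\<Sum>k\<le>m. mm p (t (j+k)) (a (2*k)) r c) = 0" for j r c
    unfolding a_def t_def m_def
    by (rule markov_relations(2)[where R = R and S = S]) (erule S0, erule R)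
  have an: "a n r c = (if r = c \<and> r < p then 1 else 0)" for r c
    using monic by (auto simp: a_def coeff_rev_def entry_def)
  have n: "n = 2 * m \<or> n = 2 * m + 1" using m_def by auto
  \<comment> \<open>For even \<open>n\<close> the leading coefficient of \<open>E\<close> is the
    identity. For odd \<open>n\<close> the relation \<open>j = m\<close> says that \<open>S\<close>
    times it is the identity.\<close>
  have lead: "\<exists>X. \<forall>v. \<forall>r<p. mv p X (mv p (a (2*m)) v) r = v r \<and> mv p (a (2*m)) (mv p X v) r = v r"
  proof (cases "even n")
    case True
    then have "n = 2 * m" using m_def by auto
    then have "mv p (a (2*m)) v r = v r" if "r < p" for v r
      using an that by (simp add: mv_def if_distrib[of "\<lambda>x. x * _"] cong: if_cong)
    then show ?thesis by (intro exI[of _ "a (2*m)"]) simp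
  next
    case False
    then have "n = 2 * m + 1" using m_def by auto
    then have "mm p S (a (2*m)) r c = (if r = c then 1 else 0)" if "r < p" "c < p" for r c
      using rel[of m r c] an[of r c] that by simp
    then show ?thesis using mm_one_imp_inverse by blast
  qed
  then obtain X where X: "\<And>v r. r < p \<Longrightarrow> mv p X (mv p (a (2*m)) v) r = v r"
    "\<And>v r. r < p \<Longrightarrow> mv p (a (2*m)) (mv p X v) r = v r" by blast
  interpret monic_markov_polynomial p m a t S n
  proof
    show "t k c r = cnj (t k r c)" if "k < 2 * m" for k r c
      using hermitian_mat_entry[OF herm[rule_format, OF that] s, of c r] by (simp add: t_def)
    show "S c r = cnj (S r c)" for r c
      using hermitian_mat_entry[OF herm_m1 sm1, of c r] by (simp add: S_def)
    show "\<exists>v. \<forall>r<p. mv p (a (2*m)) v r = w r" for w using X(2) by blast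
    show "v r = 0" if z: "\<And>r. r < p \<Longrightarrow> mv p (a (2*m)) v r = 0" and r: "r < p" for v r
    proof -
      have "mv p X (mv p (a (2*m)) v) r = mv p X (\<lambda>_. 0) r" using z by (intro mv_cong)
      then show ?thesis using X(1)[OF r, of v] by (simp add: mv_def)
    qed
    show "a i r c = 0" if "n < i" for i r c using that by (simp add: a_def coeff_rev_def)
  qed (use rel rel' an n S_even in auto)
  have stable: "hurwitz_stable (Fpoly p n A) \<longleftrightarrow> stable"
    unfolding hurwitz_stable_Fpoly a_def[symmetric] stable_def ..
  have H: "pos_def_mat (block_hankel p s d m) \<longleftrightarrow>
    (\<forall>u. (\<exists>x<m. \<exists>r<p. u x r \<noteq> 0) \<longrightarrow> 0 < Re ((-1) ^ d * hankel_form p m t d u u))" if "d \<le> 1" for d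
    by (rule pos_def_block_hankel) (use s herm that in \<open>simp_all add: t_def\<close>)
  have H0: "pos_def_mat (block_hankel p s 0 m) \<longleftrightarrow>
      (\<forall>u. (\<exists>x<m. \<exists>r<p. u x r \<noteq> 0) \<longrightarrow> 0 < Re (hankel_form p m t 0 u u))"
    using H[of 0] by simp
  have H1: "pos_def_mat (block_hankel p s 1 m) \<longleftrightarrow>
      (\<forall>u. (\<exists>x<m. \<exists>r<p. u x r \<noteq> 0) \<longrightarrow> Re (hankel_form p m t 1 u u) < 0)"
    using H[of 1] by simp
  have HS: "pos_def_mat sm1 \<longleftrightarrow> (\<forall>w. (\<exists>r<p. w r \<noteq> 0) \<longrightarrow> 0 < Re (ip p w (mv p S w)))" if "odd n"
    unfolding S_odd[OF that] by (rule pos_def_mat_entry[OF sm1[OF that] herm_m1[OF that]])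
  show ?thesis
  proof
    assume "hurwitz_stable (Fpoly p n A)"
    then have "stable" by (simp only: stable)
    then show "pos_def_mat (block_hankel p s 0 m) \<and> pos_def_mat (block_hankel p s 1 m)
           \<and> (odd n \<longrightarrow> pos_def_mat sm1)"
      unfolding H0 H1 using HS forms_of_stable by blast
  next
    assume "pos_def_mat (block_hankel p s 0 m) \<and> pos_def_mat (block_hankel p s 1 m)
           \<and> (odd n \<longrightarrow> pos_def_mat sm1)"
    then have pos0: "\<exists>x<m. \<exists>r<p. u x r \<noteq> 0 \<Longrightarrow> 0 < Re (hankel_form p m t 0 u u)"
      and pos1: "\<exists>x<m. \<exists>r<p. u x r \<noteq> 0 \<Longrightarrow> Re (hankel_form p m t 1 u u) < 0"
      and posS: "odd n \<Longrightarrow> \<exists>r<p. w r \<noteq> 0 \<Longrightarrow> 0 < Re (ip p w (mv p S w))" for u w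
      unfolding H0 H1 using HS by blast+
    have S_nonneg: "Re (ip p w (mv p S w)) \<ge> 0" for w
    proof (cases "odd n \<and> (\<exists>r<p. w r \<noteq> 0)")
      case True
      then show ?thesis using posS[of w] by simp
    next
      case False
      then have "ip p w (mv p S w) = 0" using S_even by (cases "odd n") (auto simp: ip_def mv_def)
      then show ?thesis by simp
    qed
    have "Re \<nu> < 0" if v: "\<exists>r<p. v r \<noteq> 0"
      and F: "\<And>r. r < p \<Longrightarrow> (\<Sum>i\<le>n. mv p (a i) (\<lambda>c. \<nu> ^ i * v c) r) = 0" for \<nu> v
    proof (rule eigenvalue_Re_neg[OF pos0 pos1 S_nonneg _ v])
      show "0 < Re (ip p w (mv p S w))" if "m = 0" "\<exists>r<p. w r \<noteq> 0" for w
      proof (cases "odd n")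
        case True
        then show ?thesis using posS that by blast
      next
        case False
        \<comment> \<open>Then \<open>F\<close> is the constant identity and has no nonzero null
          vector \<open>v\<close>.\<close>
        then have "n = 0" using n \<open>m = 0\<close> by auto
        then show ?thesis using v F mv_monic[of _ v] by auto
      qed
      show "tail_op 0 (\<lambda>i r. \<nu> ^ i * v r) 0 r + odd_op (\<lambda>i r. \<nu> ^ i * v r) 1 r = 0" if "r < p" for r
        unfolding sum_even_odd by (rule F[OF that])
    qed
    then have "stable" unfolding stable_def by blast
    then show "hurwitz_stable (Fpoly p n A)" by (simp only: stable)
  qed
qed
end
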